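(* Let $m$ be an even positive integer, let $i\ge1$, and let $E_i$ be a complex vector space with basis $\{e_1,\dots,e_i\}$. Then the element $\gamma_{m,i}$ defined in the context is the unique (up to a scalar multiple) nonzero element of $[S^i(S^m(E_i))]^{SL(E_i)}$.
   Context: $S^k(W)\subset\otimes^kW$ denotes symmetric tensors. Put $m'=m/2$, and let $M(i,i)$ be the space of $i\times i$ complex matrices with matrix units $E_{j,k}$. Definition of $\gamma_{m,i}$: (1) Let $\pi:\otimes^mE_i\to S^m(E_i)$ be the symmetrization projection, $\pi^*:S^m(E_i)^*\hookrightarrow(\otimes^mE_i)^*$ its dual, and let $\Theta:(\otimes^mE_i)^*\to\otimes^{m'}M(i,i)$ be the isomorphism $$\Theta(f)=\sum_{1\le j_p,k_p\le i}f(e_{j_1}\otimes e_{k_1}\otimes\cdots\otimes e_{j_{m'}}\otimes e_{k_{m'}})\,E_{j_1,k_1}\otimes\cdots\otimes E_{j_{m'},k_{m'}}.$$ Then $\Theta\circ\pi^*$ induces a linear map $S^i(S^m(E_i)^* )\to S^i(\otimes^{m'}M(i,i))$. (2) Map $S^i(\otimes^{m'}M(i,i))\subset\otimes^{im'}M(i,i)$ to $S^{im'}(M(i,i))$ by symmetrization. (3) Let $S^{im'}(M(i,i))\to\mathbb C$ be the linear functional corresponding to the homogeneous polynomial $A\mapsto(\det A)^{m'}$ of degree $im'$ on $M(i,i)$, i.e. the unique linear functional sending $A^{\otimes im'}$ to $(\det A)^{m'}$ for all $A$. The composite of these three maps is a linear functional $\gamma_{m,i}:S^i(S^m(E_i)^*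 )\to\mathbb C$. Via the canonical $GL(W)$-equivariant identification $S^i(W^* )\simeq S^i(W)^*$ (restrict from $(\otimes^iW)^*\simeq\otimes^i(W^* )$) with $W=S^m(E_i)$, $\gamma_{m,i}$ is regarded as an element of $S^i(S^m(E_i))$. *)

theory Defs
  imports
    "HOL-Library.Function_Algebras"
    "HOL-Combinatorics.Permutations"
    "Jordan_Normal_Form.Determinant"
begin

text \<open>
  Conventions. A complex vector space is a linear subspace \<open>U\<close> of the space of all functions
  \<open>'x \<Rightarrow> complex\<close> on some (arbitrary) type \<open>'x\<close>; up to isomorphism every complex vector space
  is of this form. The tensor power \<open>\<otimes>\<^sup>k U\<close> is then again of this form: it is spanned by the
  functions \<open>(x\<^sub>1, \<dots>, x\<^sub>k) \<mapsto> u\<^sub>1(x\<^sub>1) \<cdots> u\<^sub>k(x\<^sub>k)\<close> on lists of length \<open>k\<close>. (For functions the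
  canonical map from the algebraic tensor power is injective, so this really is the tensor
  power.) The dual of \<open>U\<close> consists of functions \<open>('x \<Rightarrow> complex) \<Rightarrow> complex\<close>, so it fits the same
  scheme. Indices run from \<open>0\<close> to \<open>i - 1\<close> instead of from \<open>1\<close> to \<open>i\<close>.
\<close>

definition fscale :: "complex \<Rightarrow> ('x \<Rightarrow> complex) \<Rightarrow> 'x \<Rightarrow> complex" where
  "fscale c u = (\<lambda>x. c * u x)"

global_interpretation fn: vector_space fscale
  by unfold_locales (auto simp: fscale_def fun_eq_iff algebra_simps)

text \<open>Linearity on a subspace \<open>U\<close>, where \<open>s\<close> is the scalar multiplication of the target.\<close>

definition linear_on ::
  "(complex \<Rightarrow> 'v \<Rightarrow> 'v) \<Rightarrow> ('x \<Rightarrow> complex) set \<Rightarrow> (('x \<Rightarrow> complex) \<Rightarrow> 'v::ab_group_add) \<Rightarrow> bool" where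
  "linear_on s U f \<longleftrightarrow>
     (\<forall>u\<in>U. \<forall>v\<in>U. f (u + v) = f u + f v) \<and> (\<forall>c. \<forall>u\<in>U. f (fscale c u) = s c (f u))"

text \<open>Linear functionals on \<open>U\<close>; the value \<open>0\<close> outside \<open>U\<close> makes the representation unique.\<close>

definition dual :: "('x \<Rightarrow> complex) set \<Rightarrow> (('x \<Rightarrow> complex) \<Rightarrow> complex) set" where
  "dual U = {f. linear_on (*) U f \<and> (\<forall>u. u \<notin> U \<longrightarrow> f u = 0)}"


section \<open>Tensor powers\<close>

text \<open>\<open>pure [u\<^sub>1, \<dots>, u\<^sub>k]\<close> is \<open>u\<^sub>1 \<otimes> \<cdots> \<otimes> u\<^sub>k\<close>.\<close>

definition pure :: "('x \<Rightarrow> complex) list \<Rightarrow> 'x list \<Rightarrow> complex" where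
  "pure us = (\<lambda>xs. if length xs = length us then (\<Prod>j<length us. (us ! j) (xs ! j)) else 0)"

definition tensor_power :: "nat \<Rightarrow> ('x \<Rightarrow> complex) set \<Rightarrow> ('x list \<Rightarrow> complex) set" where
  "tensor_power k U = fn.span (pure ` {us. length us = k \<and> set us \<subseteq> U})"

text \<open>
  The universal property: for a multilinear map \<open>\<phi>\<close> on \<open>U\<^sup>k\<close> this is the unique linear map on
  \<open>\<otimes>\<^sup>k U\<close> sending \<open>u\<^sub>1 \<otimes> \<cdots> \<otimes> u\<^sub>k\<close> to \<open>\<phi>(u\<^sub>1, \<dots>, u\<^sub>k)\<close>.
\<close>

definition tensor_lift ::
  "(complex \<Rightarrow> 'v \<Rightarrow> 'v) \<Rightarrow> nat \<Rightarrow> ('x \<Rightarrow> complex) set \<Rightarrow> (('x \<Rightarrow> complex) list \<Rightarrow> 'v) \<Rightarrow>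
    ('x list \<Rightarrow> complex) \<Rightarrow> 'v::ab_group_add" where
  "tensor_lift s k U \<phi> = (THE F. linear_on s (tensor_power k U) F \<and>
      (\<forall>us. length us = k \<and> set us \<subseteq> U \<longrightarrow> F (pure us) = \<phi> us) \<and>
      (\<forall>t. t \<notin> tensor_power k U \<longrightarrow> F t = 0))"

text \<open>\<open>\<otimes>\<^sup>k L\<close> for a linear map \<open>L\<close> on \<open>U\<close>; its restriction to symmetric tensors is \<open>S\<^sup>k(L)\<close>.\<close>

definition tensor_map ::
  "nat \<Rightarrow> ('x \<Rightarrow> complex) set \<Rightarrow> (('x \<Rightarrow> complex) \<Rightarrow> ('y \<Rightarrow> complex)) \<Rightarrow>
    ('x list \<Rightarrow> complex) \<Rightarrow> 'y list \<Rightarrow> complex" where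
  "tensor_map k U L = tensor_lift fscale k U (\<lambda>us. pure (map L us))"

text \<open>\<open>S\<^sup>k(U)\<close> as a subspace of \<open>\<otimes>\<^sup>k U\<close>, and the symmetrization projection of \<open>\<otimes>\<^sup>k U\<close> onto it.\<close>

definition sym_power :: "nat \<Rightarrow> ('x \<Rightarrow> complex) set \<Rightarrow> ('x list \<Rightarrow> complex) set" where
  "sym_power k U = {t \<in> tensor_power k U.
     \<forall>\<sigma>. \<sigma> permutes {..<k} \<longrightarrow> (\<lambda>xs. t (permute_list \<sigma> xs)) = t}"

definition symmetrize :: "nat \<Rightarrow> ('x list \<Rightarrow> complex) \<Rightarrow> 'x list \<Rightarrow> complex" where
  "symmetrize k t = (\<lambda>xs. (\<Sum>\<sigma> | \<sigma> permutes {..<k}. t (permute_list \<sigma> xs)) / fact k)"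

text \<open>
  The identification of \<open>\<otimes>\<^sup>k(\<otimes>\<^sup>n U)\<close> with \<open>\<otimes>\<^sup>k\<^sup>n U\<close> by concatenation: a list of length \<open>k * n\<close>
  is cut into \<open>k\<close> consecutive blocks of length \<open>n\<close>.
\<close>

definition flatten ::
  "nat \<Rightarrow> nat \<Rightarrow> ('x list list \<Rightarrow> complex) \<Rightarrow> 'x list \<Rightarrow> complex" where
  "flatten k n t = (\<lambda>xs. if length xs = k * n
     then t (map (\<lambda>j. take n (drop (j * n) xs)) [0..<k]) else 0)"


section \<open>The element \<open>\<gamma>\<^sub>m\<^sub>,\<^sub>i\<close>\<close>

text \<open>
  In this section \<open>E\<close> is a space with basis \<open>e 0, \<dots>, e (i - 1)\<close>. The space \<open>M(i,i)\<close> consists of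
  the functions on index pairs vanishing outside \<open>{..<i} \<times> {..<i}\<close>; the actual matrix
  corresponding to \<open>A\<close> is \<open>mat i i A\<close>.
\<close>

definition mat_space :: "nat \<Rightarrow> (nat \<times> nat \<Rightarrow> complex) set" where
  "mat_space i = {A. \<forall>p. p \<notin> {..<i} \<times> {..<i} \<longrightarrow> A p = 0}"

definition mat_unit :: "nat \<times> nat \<Rightarrow> nat \<times> nat \<Rightarrow> complex" where
  "mat_unit p = (\<lambda>q. if q = p then 1 else 0)"

text \<open>\<open>\<pi>\<^sup>*\<close> for \<open>\<pi> : \<otimes>\<^sup>m E \<rightarrow> S\<^sup>m(E)\<close>.\<close>

definition pi_dual ::
  "nat \<Rightarrow> ('x \<Rightarrow> complex) set \<Rightarrow> (('x list \<Rightarrow> complex) \<Rightarrow> complex) \<Rightarrow> ('x list \<Rightarrow> complex) \<Rightarrow> complex"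
  where
  "pi_dual m E f = (\<lambda>t. if t \<in> tensor_power m E then f (symmetrize m t) else 0)"

text \<open>\<open>\<Theta>\<close>, with \<open>n\<close> in the role of \<open>m' = m/2\<close>.\<close>

definition Theta ::
  "nat \<Rightarrow> nat \<Rightarrow> (nat \<Rightarrow> 'x \<Rightarrow> complex) \<Rightarrow> (('x list \<Rightarrow> complex) \<Rightarrow> complex) \<Rightarrow>
    (nat \<times> nat) list \<Rightarrow> complex" where
  "Theta n i e f = (\<Sum>ps | length ps = n \<and> set ps \<subseteq> {..<i} \<times> {..<i}.
      fscale (f (pure (concat (map (\<lambda>(j, k). [e j, e k]) ps)))) (pure (map mat_unit ps)))"

definition det_functional :: "nat \<Rightarrow> nat \<Rightarrow> ((nat \<times> nat) list \<Rightarrow> complex) \<Rightarrow> complex" where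
  "det_functional n i = (THE d. d \<in> dual (sym_power (i * n) (mat_space i)) \<and>
      (\<forall>A\<in>mat_space i. d (pure (replicate (i * n) A)) = det (mat i i A) ^ n))"

text \<open>\<open>\<gamma>\<^sub>m\<^sub>,\<^sub>i\<close> as a functional, to be applied to elements of \<open>S\<^sup>i(S\<^sup>m(E)\<^sup>*)\<close> only.\<close>

definition gamma_functional ::
  "nat \<Rightarrow> nat \<Rightarrow> ('x \<Rightarrow> complex) set \<Rightarrow> (nat \<Rightarrow> 'x \<Rightarrow> complex) \<Rightarrow>
    (('x list \<Rightarrow> complex) list \<Rightarrow> complex) \<Rightarrow> complex" where
  "gamma_functional m i E e F =
     det_functional (m div 2) i
       (symmetrize (i * (m div 2))
         (flatten i (m div 2)
           (tensor_map i (dual (sym_power m E)) (Theta (m div 2) i e \<circ> pi_dual m E) F)))"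

text \<open>
  The identification of \<open>S\<^sup>i(W\<^sup>*)\<close> with \<open>S\<^sup>i(W)\<^sup>*\<close>. An element \<open>F\<close> of \<open>\<otimes>\<^sup>i(W\<^sup>*)\<close> is literally a
  function on lists \<open>[w\<^sub>1, \<dots>, w\<^sub>i]\<close>, with \<open>f\<^sub>1 \<otimes> \<cdots> \<otimes> f\<^sub>i\<close> being \<open>[w\<^sub>1, \<dots>, w\<^sub>i] \<mapsto> f\<^sub>1(w\<^sub>1) \<cdots> f\<^sub>i(w\<^sub>i)\<close>,
  so the functional on \<open>\<otimes>\<^sup>i W\<close> belonging to \<open>F\<close> is the linear map induced by this multilinear map.
\<close>

definition dual_ident ::
  "nat \<Rightarrow> ('w \<Rightarrow> complex) set \<Rightarrow> (('w \<Rightarrow> complex) list \<Rightarrow> complex) \<Rightarrow> ('w list \<Rightarrow> complex) \<Rightarrow> complex"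
  where
  "dual_ident i W F = (\<lambda>t. if t \<in> sym_power i W then tensor_lift (*) i W F t else 0)"

text \<open>
  \<open>\<gamma>\<^sub>m\<^sub>,\<^sub>i\<close> as an element of \<open>S\<^sup>i(W)\<close>, \<open>W = S\<^sup>m(E)\<close>: the tensor at which the functional
  belonging to \<open>F\<close> takes the value \<open>\<gamma>\<^sub>m\<^sub>,\<^sub>i(F)\<close>, for all \<open>F\<close> in \<open>S\<^sup>i(W\<^sup>*)\<close>.
\<close>

definition gamma ::
  "nat \<Rightarrow> nat \<Rightarrow> ('x \<Rightarrow> complex) set \<Rightarrow> (nat \<Rightarrow> 'x \<Rightarrow> complex) \<Rightarrow> 'x list list \<Rightarrow> complex" where
  "gamma m i E e = (THE t. t \<in> sym_power i (sym_power m E) \<and>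
      (\<forall>F \<in> sym_power i (dual (sym_power m E)).
         dual_ident i (sym_power m E) F t = gamma_functional m i E e F))"


section \<open>Invariants\<close>

text \<open>Linear endomorphisms of \<open>E\<close> of determinant \<open>1\<close>, computed in the basis \<open>e 0, \<dots>, e (i - 1)\<close>.\<close>

definition SL ::
  "nat \<Rightarrow> ('x \<Rightarrow> complex) set \<Rightarrow> (nat \<Rightarrow> 'x \<Rightarrow> complex) \<Rightarrow> (('x \<Rightarrow> complex) \<Rightarrow> ('x \<Rightarrow> complex)) set" where
  "SL i E e = {g. linear_on fscale E g \<and>
     (\<exists>A \<in> carrier_mat i i. det A = 1 \<and>
        (\<forall>k<i. g (e k) = (\<Sum>j<i. fscale (A $$ (j, k)) (e j))))}"

definition SL_invariants ::
  "nat \<Rightarrow> nat \<Rightarrow> ('x \<Rightarrow> complex) set \<Rightarrow> (nat \<Rightarrow> 'x \<Rightarrow> complex) \<Rightarrow> ('x list list \<Rightarrow> complex) set" where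
  "SL_invariants m i E e = {t \<in> sym_power i (sym_power m E).
     \<forall>g \<in> SL i E e. tensor_map i (sym_power m E) (tensor_map m E g) t = t}"

end

theory Submission
  imports Defs "Jordan_Normal_Form.Char_Poly"
begin

text \<open>
  A tensor \<open>t\<close> in \<open>S\<^sup>i(S\<^sup>m(E))\<close> is determined by the function \<open>X \<mapsto> P\<^sub>t(X)\<close> on \<open>i \<times> i\<close> matrices that pairs \<open>t\<close>
  with \<open>\<xi>\<^sub>1\<^sup>m \<otimes> \<dots> \<otimes> \<xi>\<^sub>i\<^sup>m\<close>, where \<open>\<xi>\<^sub>l\<close> is the functional on \<open>E\<close> given by the \<open>l\<close>-th row of \<open>X\<close>: by
  polarization the powers \<open>\<xi>\<^sup>m\<close> span the dual of \<open>S\<^sup>m(E)\<close>. An element of \<open>SL(E)\<close> with matrix \<open>A\<close> replaces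
  \<open>X\<close> by \<open>X A\<close>. If \<open>t\<close> is invariant and \<open>d = det X \<noteq> 0\<close>, one can choose \<open>X A = diag(d, 1, \<dots>, 1)\<close>, so
  homogeneity in the first row gives \<open>P\<^sub>t(X) = P\<^sub>t(1) (det X)\<^sup>m\<close>; this extends to singular \<open>X\<close> because
  both sides are polynomial. Hence invariants are unique up to a scalar.

  The map \<open>\<Theta> \<circ> \<pi>\<^sup>*\<close> sends \<open>\<xi>\<^sup>m\<close> to the \<open>m/2\<close>-th tensor power of the rank one matrix \<open>\<xi> \<xi>\<^sup>T\<close>. Polarizing
  \<open>(det A)\<^sup>m\<^sup>/\<^sup>2\<close> by Ryser's formula expresses \<open>P\<^sub>\<gamma>(X)\<close> by the numbers
  \<open>det (\<Sum>\<^sub>l s\<^sub>l \<xi>\<^sub>l \<xi>\<^sub>l\<^sup>T) = s\<^sub>1 \<cdots> s\<^sub>i (det X)\<^sup>2\<close>, and collecting the coefficients gives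
  \<open>P\<^sub>\<gamma>(X) = c (det X)\<^sup>m\<close> where \<open>c\<close> is a positive multiple of the permanent of a block matrix of ones.
\<close>

section \<open>Linear maps on spaces of functions\<close>

text \<open>Goals produced by higher-order unification contain \<open>\<eta>\<close>-expanded functions such as
  \<open>\<lambda>x. 0 x\<close>; pointwise simp rules would turn them into \<open>\<lambda>x. 0\<close> before contraction.\<close>

declare plus_fun_apply [simp del] zero_fun_apply [simp del] minus_apply [simp del]

lemma fscale_apply: "fscale c u x = c * u x"
  by (simp add: fscale_def)

lemma sum_fun_apply: "(\<Sum>a\<in>A. h a) x = (\<Sum>a\<in>A. h a x)"
  by (induction A rule: infinite_finite_induct) (auto simp: plus_fun_apply zero_fun_apply)

lemmas pointwise = plus_fun_apply zero_fun_apply fscale_apply sum_fun_apply minus_apply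

lemma vector_space_mult: "vector_space ((*) :: complex \<Rightarrow> complex \<Rightarrow> complex)"
  by unfold_locales (auto simp: algebra_simps)

lemma vector_space_fscale: "vector_space fscale"
  by (rule fn.vector_space_axioms)

lemma linear_onI:
  assumes "\<And>u v. u \<in> U \<Longrightarrow> v \<in> U \<Longrightarrow> f (u + v) = f u + f v"
    and "\<And>c u. u \<in> U \<Longrightarrow> f (fscale c u) = s c (f u)"
  shows "linear_on s U f"
  using assms by (auto simp: linear_on_def)

lemma linear_on_add: "linear_on s U f \<Longrightarrow> u \<in> U \<Longrightarrow> v \<in> U \<Longrightarrow> f (u + v) = f u + f v"
  and linear_on_scale: "linear_on s U f \<Longrightarrow> u \<in> U \<Longrightarrow> f (fscale c u) = s c (f u)"
  by (auto simp: linear_on_def)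

lemma linear_on_0:
  assumes "vector_space s" "linear_on s U f" "fn.subspace U"
  shows "f 0 = 0"
proof -
  interpret vector_space s by fact
  have "f (fscale 0 0) = s 0 (f 0)"
    using assms by (intro linear_on_scale[OF assms(2)]) (auto simp: fn.subspace_0)
  then show ?thesis by simp
qed

lemma linear_on_sum:
  assumes "vector_space s" "linear_on s U f" "fn.subspace U" and "\<And>a. a \<in> A \<Longrightarrow> h a \<in> U"
  shows "f (\<Sum>a\<in>A. fscale (c a) (h a)) = (\<Sum>a\<in>A. s (c a) (f (h a)))"
  using assms(4)
proof (induction A rule: infinite_finite_induct)
  case (insert x F)
  then have "(\<Sum>a\<in>F. fscale (c a) (h a)) \<in> U" "fscale (c x) (h x) \<in> U"
    using assms(3) by (auto intro!: fn.subspace_sum fn.subspace_scale)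
  then show ?case using insert assms(2)
    by (simp add: linear_on_add linear_on_scale)
qed (use linear_on_0[OF assms(1-3)] in auto)

lemma linear_on_span_eqI:
  assumes "vector_space s" "linear_on s (fn.span B) f" "linear_on s (fn.span B) g"
    and "\<And>b. b \<in> B \<Longrightarrow> f b = g b" and "t \<in> fn.span B"
  shows "f t = g t"
proof -
  have "t \<in> fn.span B \<and> f t = g t"
    using assms(5)
  proof (induction rule: fn.span_induct_alt)
    case base
    show ?case
      using linear_on_0[OF assms(1,2) fn.subspace_span] linear_on_0[OF assms(1,3) fn.subspace_span]
      by (simp add: fn.span_zero)
  next
    case (step c x y)
    have "x \<in> fn.span B" "fscale c x \<in> fn.span B"
      using step by (auto simp: fn.span_base fn.span_scale)
    then show ?case
      using step assms(2-4) by (simp add: linear_on_add linear_on_scale fn.span_add)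
  qed
  then show ?thesis ..
qed

lemma linear_on_mono: "linear_on s U f \<Longrightarrow> V \<subseteq> U \<Longrightarrow> linear_on s V f"
  unfolding linear_on_def by blast

lemma linear_on_compose:
  assumes "linear_on fscale U f" "linear_on s V g" "f ` U \<subseteq> V"
  shows "linear_on s U (\<lambda>u. g (f u))"
  using assms by (auto simp: linear_on_def image_subset_iff)

lemma linear_on_span_image:
  assumes "linear_on fscale (fn.span B) f" "\<And>b. b \<in> B \<Longrightarrow> f b \<in> V" "fn.subspace V" "t \<in> fn.span B"
  shows "f t \<in> V"
proof -
  have "t \<in> fn.span B \<and> f t \<in> V"
    using assms(4)
  proof (induction rule: fn.span_induct_alt)
    case base
    show ?case
      using linear_on_0[OF vector_space_fscale assms(1) fn.subspace_span] assms(3)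
      by (simp add: fn.span_zero fn.subspace_0)
  next
    case (step c x y)
    have "x \<in> fn.span B" "fscale c x \<in> fn.span B"
      using step by (auto simp: fn.span_base fn.span_scale)
    then show ?case
      using step assms
      by (simp add: linear_on_add linear_on_scale fn.span_add fn.subspace_add fn.subspace_scale)
  qed
  then show ?thesis ..
qed

section \<open>Dual spaces of spaces of functions\<close>

lemma dual_linear: "f \<in> dual U \<Longrightarrow> linear_on (*) U f"
  by (simp add: dual_def)

lemma dual_outside: "f \<in> dual U \<Longrightarrow> u \<notin> U \<Longrightarrow> f u = 0"
  by (simp add: dual_def)

lemma subspace_dual: "fn.subspace U \<Longrightarrow> fn.subspace (dual U)"
  unfolding fn.subspace_def dual_def linear_on_def by (auto simp: pointwise algebra_simps)

lemma restrict_in_dual: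
  assumes "fn.subspace U" "linear_on (*) U f"
  shows "(\<lambda>u. if u \<in> U then f u else 0) \<in> dual U"
  using assms unfolding dual_def linear_on_def
  by (auto simp: fn.subspace_add fn.subspace_scale)

section \<open>Finite-dimensional spaces and interpolation at finitely many points\<close>

definition fin_dim :: "('x \<Rightarrow> complex) set \<Rightarrow> bool" where
  "fin_dim U \<longleftrightarrow> (\<exists>B. finite B \<and> U = fn.span B)"

lemma fin_dim_span: "finite B \<Longrightarrow> fin_dim (fn.span B)"
  by (auto simp: fin_dim_def)

lemma fin_dim_subspace: "fin_dim U \<Longrightarrow> fn.subspace U"
  by (auto simp: fin_dim_def)

text \<open>Induction on a spanning set. A new vector that is not yet reproduced by the current
  points has a residual that is nonzero somewhere, and one such place becomes an additional point.
  Coordinates of vectors are thus ordinary function values, which later serve as coefficients of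
  tensors and as functionals.\<close>

lemma fin_dim_interpolation:
  assumes "fin_dim U"
  shows "\<exists>X b. finite X \<and> b ` X \<subseteq> U \<and> (\<forall>u\<in>U. u = (\<Sum>x\<in>X. fscale (u x) (b x)))"
proof -
  from assms obtain B where "finite B" and U: "U = fn.span B"
    by (auto simp: fin_dim_def)
  have "\<exists>X b. finite X \<and> b ` X \<subseteq> fn.span B \<and>
    (\<forall>u\<in>fn.span B. u = (\<Sum>x\<in>X. fscale (u x) (b x)))"
    using \<open>finite B\<close>
  proof (induction B)
    case empty
    show ?case by (rule exI[of _ "{}"]) auto
  next
    case (insert v B)
    then obtain X b where X: "finite X" "b ` X \<subseteq> fn.span B"
      and interp: "\<And>u. u \<in> fn.span B \<Longrightarrow> u = (\<Sum>x\<in>X. fscale (u x) (b x))"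
      by blast
    \<comment> \<open>The interpolation error. It vanishes on the old span and maps the enlarged
      span into the line through \<open>rest v\<close>.\<close>
    define rest where "rest = (\<lambda>u. u - (\<Sum>x\<in>X. fscale (u x) (b x)))"
    have rest0: "rest u = 0" if "u \<in> fn.span B" for u
      using interp[OF that] by (simp add: rest_def)
    have rest_lin: "rest (u - fscale c w) = rest u - fscale c (rest w)" for u w c
      by (rule ext) (simp add: rest_def pointwise algebra_simps sum_subtractf sum_distrib_left)
    have "fn.span B \<subseteq> fn.span (insert v B)" by (intro fn.span_mono) auto
    then have bX: "b ` X \<subseteq> fn.span (insert v B)" using X(2) by blast
    have mem: "rest v \<in> fn.span (insert v B)"
      unfolding rest_def using bX
      by (intro fn.span_diff fn.span_sum fn.span_scale) (auto intro: fn.span_base)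
    have split: "\<exists>k. rest u = fscale k (rest v)" if "u \<in> fn.span (insert v B)" for u
    proof -
      from that obtain k where "u - fscale k v \<in> fn.span B"
        unfolding fn.span_insert by blast
      from rest0[OF this] show ?thesis
        by (metis rest_lin eq_iff_diff_eq_0)
    qed
    show ?case
    proof (cases "rest v = 0")
      case True
      have "rest u = 0" if "u \<in> fn.span (insert v B)" for u
        using split[OF that] True by (auto simp: pointwise fun_eq_iff)
      then show ?thesis using X(1) bX unfolding rest_def
        by (metis eq_iff_diff_eq_0)
    next
      case False
      then obtain y where y: "rest v y \<noteq> 0" by (auto simp: pointwise fun_eq_iff)
      \<comment> \<open>Normalized to \<open>w y = 1\<close>, so that
        \<open>rest u = fscale (rest u y) w\<close> on the enlarged span.\<close>
      define w where "w = fscale (1 / rest v y) (rest v)"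
      have wmem: "w \<in> fn.span (insert v B)"
        unfolding w_def using mem by (rule fn.span_scale)
      \<comment> \<open>Obtained from \<open>u = (\<Sum>x\<in>X. fscale (u x) (b x)) + fscale (rest
        u y) w\<close> by expanding \<open>rest u y\<close> and collecting the coefficient of each
        \<open>u x\<close>. The point \<open>y\<close> may already belong to \<open>X\<close>; then
        both contributions are added.\<close>
      define b' where "b' = (\<lambda>x. if x = y then w + (if x \<in> X then b x - fscale (b x y) w else 0)
         else b x - fscale (b x y) w)"
      have exp: "u = (\<Sum>x\<in>insert y X. fscale (u x) (b' x))" if u: "u \<in> fn.span (insert v B)" for u
      proof -
        obtain k where k: "rest u = fscale k (rest v)" using split[OF u] by blast
        have k': "rest u = fscale (rest u y) w"
          using y by (auto simp: k w_def fun_eq_iff pointwise)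
        have fin: "finite (insert y X)" using X by simp
        have "(\<Sum>x\<in>insert y X. fscale (u x) (b' x)) =
            (\<Sum>x\<in>insert y X. (if x = y then fscale (u x) w else 0) +
                (if x \<in> X then fscale (u x) (b x - fscale (b x y) w) else 0))"
          by (intro sum.cong) (auto simp: b'_def pointwise fun_eq_iff algebra_simps)
        also have "\<dots> = fscale (u y) w + (\<Sum>x\<in>X. fscale (u x) (b x - fscale (b x y) w))"
          unfolding sum.distrib
        proof (rule arg_cong2[where f = "(+)"])
          show "(\<Sum>x\<in>insert y X. if x = y then fscale (u x) w else 0) = fscale (u y) w"
            using fin by (simp only: sum.delta) simp
          show "(\<Sum>x\<in>insert y X. if x \<in> X then fscale (u x) (b x - fscale (b x y) w) else 0) =
              (\<Sum>x\<in>X. fscale (u x) (b x - fscale (b x y) w))"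
            by (rule sum.mono_neutral_cong_right[OF fin]) auto
        qed
        also have "\<dots> = u"
        proof (rule ext)
          fix z
          have ru: "rest u y = u y - (\<Sum>x\<in>X. u x * b x y)" by (simp add: rest_def pointwise)
          have "rest u z = u z - (\<Sum>x\<in>X. u x * b x z)" by (simp add: rest_def pointwise)
          also have "rest u z = rest u y * w z" using fun_cong[OF k', of z] by (simp add: fscale_apply)
          finally have "u z = rest u y * w z + (\<Sum>x\<in>X. u x * b x z)" by simp
          then show "(fscale (u y) w + (\<Sum>x\<in>X. fscale (u x) (b x - fscale (b x y) w))) z = u z"
            unfolding ru
            by (simp add: pointwise algebra_simps sum_subtractf sum_distrib_left)
        qed
        finally show ?thesis by simp
      qed
      have "b' x \<in> fn.span (insert v B)" if x: "x \<in> insert y X" for x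
      proof -
        have "b x - fscale (b x y) w \<in> fn.span (insert v B)" if "x \<in> X"
          using that bX wmem by (intro fn.span_diff fn.span_scale) auto
        then show ?thesis
          using x wmem fn.span_add[OF wmem] unfolding b'_def by (auto simp: fn.span_zero)
      qed
      then have "b' ` insert y X \<subseteq> fn.span (insert v B)" by blast
      then show ?thesis using exp X(1) by blast
    qed
  qed
  then show ?thesis unfolding U .
qed

definition evaluation :: "('x \<Rightarrow> complex) set \<Rightarrow> 'x \<Rightarrow> ('x \<Rightarrow> complex) \<Rightarrow> complex" where
  "evaluation U y = (\<lambda>u. if u \<in> U then u y else 0)"

lemma evaluation_in_dual: "fn.subspace U \<Longrightarrow> evaluation U y \<in> dual U"
  unfolding evaluation_def by (intro restrict_in_dual linear_onI) (auto simp: pointwise)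

text \<open>Apply \<open>f\<close> to the interpolation formula. As a consequence the evaluations at
  the points of \<open>X\<close> generate the dual.\<close>

lemma dual_interpolation:
  assumes U: "fn.subspace U" and X: "finite X" "b ` X \<subseteq> U"
    and interp: "\<And>u. u \<in> U \<Longrightarrow> u = (\<Sum>x\<in>X. fscale (u x) (b x))"
    and f: "f \<in> dual U"
  shows "f = (\<Sum>x\<in>X. fscale (f (b x)) (evaluation U x))"
proof
  fix u
  show "f u = (\<Sum>x\<in>X. fscale (f (b x)) (evaluation U x)) u"
  proof (cases "u \<in> U")
    case True
    have "f u = f (\<Sum>x\<in>X. fscale (u x) (b x))" using interp[OF True] by simp
    also have "\<dots> = (\<Sum>x\<in>X. u x * f (b x))"
      using X by (intro linear_on_sum[OF vector_space_mult dual_linear[OF f] U]) auto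
    finally show ?thesis using True by (simp add: pointwise evaluation_def mult.commute)
  next
    case False
    then show ?thesis using f by (simp add: pointwise evaluation_def dual_outside)
  qed
qed

lemma fin_dim_dual:
  assumes "fin_dim U"
  shows "fin_dim (dual U)"
proof -
  note sub = fin_dim_subspace[OF assms]
  obtain X b where X: "finite X" "b ` X \<subseteq> U"
    and interp: "\<And>u. u \<in> U \<Longrightarrow> u = (\<Sum>x\<in>X. fscale (u x) (b x))"
    using fin_dim_interpolation[OF assms] by blast
  have "f \<in> fn.span (evaluation U ` X)" if f: "f \<in> dual U" for f
  proof -
    have "f = (\<Sum>x\<in>X. fscale (f (b x)) (evaluation U x))"
      by (rule dual_interpolation[OF sub X _ f]) (rule interp)
    also have "\<dots> \<in> fn.span (evaluation U ` X)"
      by (intro fn.span_sum fn.span_scale fn.span_base imageI)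
    finally show ?thesis .
  qed
  moreover have "fn.span (evaluation U ` X) \<subseteq> dual U"
    using evaluation_in_dual[OF sub] subspace_dual[OF sub] by (intro fn.span_minimal) auto
  ultimately have "dual U = fn.span (evaluation U ` X)" by blast
  then show ?thesis using X(1) by (simp add: fin_dim_span)
qed


section \<open>Tensor powers and multilinear maps\<close>

abbreviation words :: "'a set \<Rightarrow> nat \<Rightarrow> 'a list set" where
  "words X k \<equiv> {xs. length xs = k \<and> set xs \<subseteq> X}"

lemma finite_words: "finite X \<Longrightarrow> finite (words X k)"
  using finite_lists_length_eq[of X k] by (simp add: conj_commute)

lemma words_0: "words X 0 = {[]}"
  by auto

lemma words_Suc: "words X (Suc k) = (\<lambda>(x, xs). x # xs) ` (X \<times> words X k)"
  by (auto simp: length_Suc_conv image_iff)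

lemma sum_words_Suc:
  "(\<Sum>xs\<in>words X (Suc k). h xs) = (\<Sum>x\<in>X. \<Sum>xs\<in>words X k. h (x # xs))"
proof -
  have "inj_on (\<lambda>(x, xs). x # xs) (X \<times> words X k)" by (auto simp: inj_on_def)
  then show ?thesis
    unfolding words_Suc by (simp add: sum.reindex sum.cartesian_product case_prod_unfold)
qed

lemma pure_Cons: "pure (u # us) (x # xs) = u x * pure us xs"
  by (simp add: pure_def prod.lessThan_Suc_shift del: prod.lessThan_Suc)

lemma pure_Cons_Nil: "pure (u # us) [] = 0"
  by (simp add: pure_def)

lemma pure_length_neq: "length xs \<noteq> length us \<Longrightarrow> pure us xs = 0"
  by (simp add: pure_def)

lemma pure_length_eq: "length xs = length us \<Longrightarrow> pure us xs = (\<Prod>j<length us. (us ! j) (xs ! j))"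
  by (simp add: pure_def)

lemma pure_update:
  assumes "l < length us"
  shows "pure (us[l := u]) xs = (if length xs = length us
    then u (xs ! l) * (\<Prod>j\<in>{..<length us} - {l}. (us ! j) (xs ! j)) else 0)"
proof (cases "length xs = length us")
  case True
  have "pure (us[l := u]) xs = (\<Prod>j<length us. (us[l := u] ! j) (xs ! j))"
    using True by (simp add: pure_def)
  also have "\<dots> = (us[l := u] ! l) (xs ! l) * (\<Prod>j\<in>{..<length us} - {l}. (us[l := u] ! j) (xs ! j))"
    using assms by (intro prod.remove) auto
  also have "(\<Prod>j\<in>{..<length us} - {l}. (us[l := u] ! j) (xs ! j)) =
      (\<Prod>j\<in>{..<length us} - {l}. (us ! j) (xs ! j))"
    by (intro prod.cong) auto
  finally show ?thesis using assms True by simp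
qed (simp add: pure_def)

lemma pure_update_arg:
  assumes "l < length us" "length xs = length us"
  shows "pure us (xs[l := x]) = (us ! l) x * (\<Prod>j\<in>{..<length us} - {l}. (us ! j) (xs ! j))"
proof -
  have "pure us (xs[l := x]) = (\<Prod>j<length us. (us ! j) (xs[l := x] ! j))"
    using assms by (simp add: pure_def)
  also have "\<dots> = (us ! l) (xs[l := x] ! l) * (\<Prod>j\<in>{..<length us} - {l}. (us ! j) (xs[l := x] ! j))"
    using assms by (intro prod.remove) auto
  also have "(\<Prod>j\<in>{..<length us} - {l}. (us ! j) (xs[l := x] ! j)) =
      (\<Prod>j\<in>{..<length us} - {l}. (us ! j) (xs ! j))"
    by (intro prod.cong) auto
  finally show ?thesis using assms by simp
qed

lemma subspace_tensor_power: "fn.subspace (tensor_power k U)"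
  by (simp add: tensor_power_def)

lemma pure_in_tensor_power: "length us = k \<Longrightarrow> set us \<subseteq> U \<Longrightarrow> pure us \<in> tensor_power k U"
  unfolding tensor_power_def by (rule fn.span_base) auto

lemma tensor_power_length_neq:
  assumes "t \<in> tensor_power k U" "length xs \<noteq> k"
  shows "t xs = 0"
proof -
  have "fn.subspace {t. \<forall>xs. length xs \<noteq> k \<longrightarrow> t xs = (0::complex)}"
    by (auto simp: fn.subspace_def pointwise)
  then have "tensor_power k U \<subseteq> {t. \<forall>xs. length xs \<noteq> k \<longrightarrow> t xs = (0::complex)}"
    unfolding tensor_power_def by (intro fn.span_minimal) (auto simp: pure_length_neq)
  with assms show ?thesis by auto
qed

text \<open>Multilinearity lets each factor be expanded in the generators: the induction handles the
  tail of the list, linearity in the first slot handles the head.\<close>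

lemma tensor_power_span: "tensor_power k (fn.span G) = fn.span (pure ` words G k)"
proof
  have "pure us \<in> fn.span (pure ` words G k)" if "us \<in> words (fn.span G) k" for us
    using that
  proof (induction k arbitrary: us)
    case 0
    then have "us = []" by simp
    then show ?case by (intro fn.span_base) auto
  next
    case (Suc k)
    let ?V = "fn.span (pure ` words G (Suc k))"
    from Suc.prems obtain u us' where us: "us = u # us'" and u: "u \<in> fn.span G"
      and us': "us' \<in> words (fn.span G) k"
      by (auto simp: length_Suc_conv)
    have tail: "pure us' \<in> fn.span (pure ` words G k)" using Suc.IH[OF us'] .
    have "pure (g # us') \<in> ?V" if g: "g \<in> G" for g
    proof -
      \<comment> \<open>\<open>Q\<close> is left tensoring with \<open>g\<close>. Being linear, it
        carries membership of the tail in its span over to the longer tensors.\<close>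
      define Q where "Q = (\<lambda>t (xs::'a list). case xs of [] \<Rightarrow> 0 | x # ys \<Rightarrow> g x * (t ys :: complex))"
      have Q_pure: "Q (pure vs) = pure (g # vs)" for vs
        by (rule ext) (simp add: Q_def pure_Cons pure_Cons_Nil split: list.split)
      have "linear_on fscale (fn.span (pure ` words G k)) Q"
        by (intro linear_onI ext) (simp_all add: Q_def pointwise algebra_simps split: list.split)
      moreover have "Q v \<in> ?V" if "v \<in> pure ` words G k" for v
        using that g by (auto simp: Q_pure intro!: fn.span_base imageI)
      ultimately have "Q (pure us') \<in> ?V"
        using tail by (rule linear_on_span_image[OF _ _ fn.subspace_span])
      then show ?thesis by (simp add: Q_pure)
    qed
    note gen = this
    have "linear_on fscale (fn.span G) (\<lambda>u. pure (u # us'))"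
    proof (intro linear_onI ext)
      show "pure ((u + v) # us') xs = (pure (u # us') + pure (v # us')) xs" for u v xs
        by (cases xs) (simp_all add: pure_Cons pure_Cons_Nil pointwise algebra_simps)
      show "pure (fscale c u # us') xs = fscale c (pure (u # us')) xs" for c u xs
        by (cases xs) (simp_all add: pure_Cons pure_Cons_Nil pointwise algebra_simps)
    qed
    then have "pure (u # us') \<in> ?V"
      using gen fn.subspace_span u by (rule linear_on_span_image)
    then show ?case by (simp add: us)
  qed
  then show "tensor_power k (fn.span G) \<subseteq> fn.span (pure ` words G k)"
    unfolding tensor_power_def by (intro fn.span_minimal) auto
  show "fn.span (pure ` words G k) \<subseteq> tensor_power k (fn.span G)"
    unfolding tensor_power_def by (intro fn.span_mono) (auto intro: fn.span_base)
qed

lemma fin_dim_tensor_power: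
  assumes "fin_dim U"
  shows "fin_dim (tensor_power k U)"
proof -
  from assms obtain B where B: "finite B" "U = fn.span B" by (auto simp: fin_dim_def)
  show ?thesis unfolding B(2) tensor_power_span
    by (rule fin_dim_span[OF finite_imageI[OF finite_words[OF B(1)]]])
qed

lemma linear_on_tensor_power_eqI:
  assumes "vector_space s" "linear_on s (tensor_power k U) f" "linear_on s (tensor_power k U) g"
    and "\<And>us. length us = k \<Longrightarrow> set us \<subseteq> U \<Longrightarrow> f (pure us) = g (pure us)"
    and "t \<in> tensor_power k U"
  shows "f t = g t"
  by (rule linear_on_span_eqI[OF assms(1) assms(2)[unfolded tensor_power_def]
        assms(3)[unfolded tensor_power_def] _ assms(5)[unfolded tensor_power_def]])
    (auto simp: assms(4))

lemma linear_on_tensor_power_image: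
  assumes "linear_on fscale (tensor_power k U) f"
    and "\<And>us. length us = k \<Longrightarrow> set us \<subseteq> U \<Longrightarrow> f (pure us) \<in> V"
    and "fn.subspace V" "t \<in> tensor_power k U"
  shows "f t \<in> V"
  by (rule linear_on_span_image[OF assms(1)[unfolded tensor_power_def] _ assms(3)
        assms(4)[unfolded tensor_power_def]])
    (auto simp: assms(2))

section \<open>Multilinear maps and the universal property\<close>

definition multilin ::
  "(complex \<Rightarrow> 'v \<Rightarrow> 'v) \<Rightarrow> nat \<Rightarrow> ('x \<Rightarrow> complex) set \<Rightarrow>
    (('x \<Rightarrow> complex) list \<Rightarrow> 'v::ab_group_add) \<Rightarrow> bool" where
  "multilin s k U \<phi> \<longleftrightarrow> (\<forall>us l. length us = k \<and> set us \<subseteq> U \<and> l < k \<longrightarrow>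
     linear_on s U (\<lambda>u. \<phi> (us[l := u])))"

lemma multilin_Cons:
  assumes "multilin s (Suc k) U \<phi>"
  shows "u \<in> U \<Longrightarrow> multilin s k U (\<lambda>us. \<phi> (u # us))"
    and "length us = k \<Longrightarrow> set us \<subseteq> U \<Longrightarrow> linear_on s U (\<lambda>u. \<phi> (u # us))"
proof -
  assume u: "u \<in> U"
  show "multilin s k U (\<lambda>us. \<phi> (u # us))"
    unfolding multilin_def
  proof (intro allI impI)
    fix us l assume "length us = k \<and> set us \<subseteq> U \<and> l < k"
    with assms u have "linear_on s U (\<lambda>v. \<phi> ((u # us)[Suc l := v]))"
      unfolding multilin_def by (metis Suc_less_eq insert_subset length_Cons list.set(2))
    then show "linear_on s U (\<lambda>v. \<phi> (u # us[l := v]))" by simp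
  qed
next
  assume us: "length us = k" "set us \<subseteq> U"
  show "linear_on s U (\<lambda>u. \<phi> (u # us))"
    unfolding linear_on_def
  proof (intro conjI ballI allI)
    \<comment> \<open>The overwritten entry must come from \<open>U\<close> for
      \<open>multilin\<close> to apply, so a vector at hand is used as filler.\<close>
    have lin: "linear_on s U (\<lambda>v. \<phi> ((w # us)[0 := v]))" if "w \<in> U" for w
      using assms us that unfolding multilin_def
      by (metis insert_subset length_Cons list.set(2) zero_less_Suc)
    show "\<phi> ((u + v) # us) = \<phi> (u # us) + \<phi> (v # us)" if "u \<in> U" "v \<in> U" for u v
      using linear_on_add[OF lin[OF that(1)] that] by simp
    show "\<phi> (fscale c u # us) = s c (\<phi> (u # us))" if "u \<in> U" for c u
      using linear_on_scale[OF lin[OF that] that] by simp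
  qed
qed

text \<open>Distributivity in all slots. The coefficients \<open>co u x\<close> stay abstract
  because the expansion is used both for vectors, with \<open>u x\<close>, and for functionals, with
  \<open>f (b x)\<close>.\<close>

lemma multilin_expand:
  fixes us :: "('x \<Rightarrow> complex) list"
  assumes s: "vector_space s" and U: "fn.subspace U" and X: "finite X" "g ` X \<subseteq> U"
  shows "multilin s k U \<phi> \<Longrightarrow> length us = k \<Longrightarrow> set us \<subseteq> U \<Longrightarrow>
    (\<And>u. u \<in> set us \<Longrightarrow> u = (\<Sum>x\<in>X. fscale (co u x) (g x))) \<Longrightarrow>
    \<phi> us = (\<Sum>xs\<in>words X k. s (\<Prod>j<k. co (us ! j) (xs ! j)) (\<phi> (map g xs)))"
proof (induction us arbitrary: \<phi> k)
  case Nil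
  interpret vector_space s by fact
  from Nil have k: "k = 0" by simp
  show ?case unfolding k words_0 by simp
next
  case (Cons u us)
  interpret vector_space s by fact
  from Cons.prems obtain k' where k: "k = Suc k'" and us: "length us = k'" "set us \<subseteq> U" "u \<in> U"
    by auto
  have "\<phi> (u # us) = \<phi> ((\<Sum>x\<in>X. fscale (co u x) (g x)) # us)"
    using Cons.prems(4)[of u] by simp
  also have "\<dots> = (\<Sum>x\<in>X. s (co u x) (\<phi> (g x # us)))"
    using X by (intro linear_on_sum[OF s multilin_Cons(2)[OF Cons.prems(1)[unfolded k] us(1,2)] U]) auto
  also have "\<dots> = (\<Sum>x\<in>X. s (co u x)
      (\<Sum>xs\<in>words X k'. s (\<Prod>j<k'. co (us ! j) (xs ! j)) (\<phi> (g x # map g xs))))"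
  proof (rule sum.cong[OF refl])
    fix x assume "x \<in> X"
    with X have "g x \<in> U" by auto
    then have "\<phi> (g x # us) = (\<Sum>xs\<in>words X k'. s (\<Prod>j<k'. co (us ! j) (xs ! j)) (\<phi> (g x # map g xs)))"
      using Cons.prems us by (intro Cons.IH multilin_Cons(1)[OF Cons.prems(1)[unfolded k]]) auto
    then show "s (co u x) (\<phi> (g x # us)) = s (co u x)
        (\<Sum>xs\<in>words X k'. s (\<Prod>j<k'. co (us ! j) (xs ! j)) (\<phi> (g x # map g xs)))" by simp
  qed
  also have "\<dots> = (\<Sum>xs\<in>words X k. s (\<Prod>j<k. co ((u # us) ! j) (xs ! j)) (\<phi> (map g xs)))"
    unfolding k sum_words_Suc by (simp add: scale_sum_right prod.lessThan_Suc_shift del: prod.lessThan_Suc)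
  finally show ?case .
qed

lemma multilin_pure_map:
  assumes "linear_on fscale U L"
  shows "multilin fscale k U (\<lambda>us. pure (map L us))"
  unfolding multilin_def
proof (intro allI impI)
  fix us l assume us: "length us = k \<and> set us \<subseteq> U \<and> l < k"
  show "linear_on fscale U (\<lambda>u. pure (map L (us[l := u])))"
    using assms us
    by (intro linear_onI ext)
      (auto simp: map_update pure_update pointwise linear_on_add[OF assms] linear_on_scale[OF assms]
        algebra_simps)
qed

lemma multilin_pure: "multilin fscale k U pure"
  using multilin_pure_map[of U "\<lambda>u. u" k] by (simp add: linear_on_def)

lemma subspace_multilin: "fn.subspace {F. multilin (*) k U F}"
  by (auto simp: fn.subspace_def multilin_def linear_on_def pointwise algebra_simps)

text \<open>Tensors of functionals are literally functions on lists of vectors. A pure one is linear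
  in each slot, and multilinear functions form a subspace.\<close>

lemma multilin_tensor_power_dual:
  assumes "F \<in> tensor_power k (dual U)"
  shows "multilin (*) k U F"
proof -
  have "multilin (*) k U (pure fs)" if fs: "length fs = k" "set fs \<subseteq> dual U" for fs
    unfolding multilin_def
  proof (intro allI impI)
    fix us l assume us: "length us = k \<and> set us \<subseteq> U \<and> l < k"
    with fs have "fs ! l \<in> dual U" by (metis nth_mem subset_iff)
    then have lin: "linear_on (*) U (fs ! l)" by (rule dual_linear)
    show "linear_on (*) U (\<lambda>u. pure fs (us[l := u]))"
      using us fs
      by (intro linear_onI)
        (auto simp: pure_update_arg linear_on_add[OF lin] linear_on_scale[OF lin] algebra_simps)
  qed
  then have "tensor_power k (dual U) \<subseteq> {F. multilin (*) k U F}"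
    unfolding tensor_power_def by (intro fn.span_minimal subspace_multilin) auto
  with assms show ?thesis by auto
qed

text \<open>Resolves the definite description in \<open>tensor_lift\<close>. Uniqueness holds
  because pure tensors span; existence comes from the explicit map \<open>G\<close>.\<close>

lemma tensor_lift_characterization:
  assumes s: "vector_space s" and U: "fin_dim U" and \<phi>: "multilin s k U \<phi>"
  shows "linear_on s (tensor_power k U) (tensor_lift s k U \<phi>) \<and>
    (\<forall>us. length us = k \<and> set us \<subseteq> U \<longrightarrow> tensor_lift s k U \<phi> (pure us) = \<phi> us) \<and>
    (\<forall>t. t \<notin> tensor_power k U \<longrightarrow> tensor_lift s k U \<phi> t = 0)"
proof -
  interpret V: vector_space s by fact
  obtain X b where X: "finite X" "b ` X \<subseteq> U"
    and interp: "\<And>u. u \<in> U \<Longrightarrow> u = (\<Sum>x\<in>X. fscale (u x) (b x))"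
    using fin_dim_interpolation[OF U] by blast
  \<comment> \<open>A tensor is itself a function on words, so its values at words over the
    interpolation points can be used as coefficients. This makes \<open>G\<close> visibly linear,
    and \<open>multilin_expand\<close> yields its values on pure tensors.\<close>
  define G where "G = (\<lambda>t. if t \<in> tensor_power k U
    then \<Sum>xs\<in>words X k. s (t xs) (\<phi> (map b xs)) else 0)"
  let ?P = "\<lambda>F. linear_on s (tensor_power k U) F \<and>
      (\<forall>us. length us = k \<and> set us \<subseteq> U \<longrightarrow> F (pure us) = \<phi> us) \<and>
      (\<forall>t. t \<notin> tensor_power k U \<longrightarrow> F t = 0)"
  have "?P G"
  proof (intro conjI allI impI)
    show "linear_on s (tensor_power k U) G"
    proof (rule linear_onI)
      fix u v c assume u: "u \<in> tensor_power k U"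
      from u have "fscale c u \<in> tensor_power k U"
        by (rule fn.subspace_scale[OF subspace_tensor_power])
      with u show "G (fscale c u) = s c (G u)"
        unfolding G_def by (simp add: fscale_apply V.scale_sum_right)
      assume v: "v \<in> tensor_power k U"
      with u have "u + v \<in> tensor_power k U"
        by (rule fn.subspace_add[OF subspace_tensor_power])
      with u v show "G (u + v) = G u + G v"
        unfolding G_def by (simp add: plus_fun_apply V.scale_left_distrib sum.distrib)
    qed
    show "G t = 0" if "t \<notin> tensor_power k U" for t using that by (simp add: G_def)
    fix us assume us: "length us = k \<and> set us \<subseteq> U"
    have "\<phi> us = (\<Sum>xs\<in>words X k. s (\<Prod>j<k. (us ! j) (xs ! j)) (\<phi> (map b xs)))"
      using us interp by (intro multilin_expand[OF s fin_dim_subspace[OF U] X \<phi>]) auto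
    then show "G (pure us) = \<phi> us"
      using us by (simp add: G_def pure_in_tensor_power pure_length_eq)
  qed
  moreover have "F = G" if F: "?P F" for F
  proof
    fix t
    show "F t = G t"
    proof (cases "t \<in> tensor_power k U")
      case True
      with F \<open>?P G\<close> show ?thesis
        by (simp add: linear_on_tensor_power_eqI[OF s, of k U F G])
    next
      case False
      with F \<open>?P G\<close> show ?thesis by simp
    qed
  qed
  ultimately have "\<exists>!F. ?P F" by (rule ex1I)
  from theI'[OF this] show ?thesis unfolding tensor_lift_def .
qed

lemmas tensor_lift_linear = tensor_lift_characterization[THEN conjunct1]

lemma tensor_lift_pure:
  assumes "vector_space s" "fin_dim U" "multilin s k U \<phi>" "length us = k" "set us \<subseteq> U"
  shows "tensor_lift s k U \<phi> (pure us) = \<phi> us"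
  using tensor_lift_characterization[OF assms(1-3)] assms(4,5) by auto

lemma tensor_map_linear:
  "fin_dim U \<Longrightarrow> linear_on fscale U L \<Longrightarrow> linear_on fscale (tensor_power k U) (tensor_map k U L)"
  unfolding tensor_map_def
  by (intro tensor_lift_linear vector_space_fscale multilin_pure_map)

lemma tensor_map_pure:
  "fin_dim U \<Longrightarrow> linear_on fscale U L \<Longrightarrow> length us = k \<Longrightarrow> set us \<subseteq> U \<Longrightarrow>
    tensor_map k U L (pure us) = pure (map L us)"
  unfolding tensor_map_def
  by (subst tensor_lift_pure) (auto intro: vector_space_fscale multilin_pure_map)


section \<open>Symmetric tensors\<close>

text \<open>Reindexing the product over the slots moves the permutation from the arguments to the
  factors, where it appears inverted.\<close>

lemma pure_permute:
  assumes "length us = k" "\<sigma> permutes {..<k}"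
  shows "(\<lambda>xs. pure us (permute_list \<sigma> xs)) = pure (permute_list (inv_into UNIV \<sigma>) us)"
proof
  fix xs
  show "pure us (permute_list \<sigma> xs) = pure (permute_list (inv_into UNIV \<sigma>) us) xs"
  proof (cases "length xs = k")
    case True
    have "pure us (permute_list \<sigma> xs) = (\<Prod>j<k. (us ! j) (xs ! \<sigma> j))"
      using assms True by (simp add: pure_def permute_list_nth)
    also have "\<dots> = (\<Prod>j<k. (us ! inv_into UNIV \<sigma> j) (xs ! j))"
      using prod.permute[OF assms(2), of "\<lambda>j. (us ! inv_into UNIV \<sigma> j) (xs ! j)"]
      by (simp add: o_def permutes_inverses[OF assms(2)])
    also have "\<dots> = pure (permute_list (inv_into UNIV \<sigma>) us) xs"
      using assms True permutes_inv[OF assms(2)] by (simp add: pure_def permute_list_nth)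
    finally show ?thesis .
  qed (use assms in \<open>simp add: pure_length_neq\<close>)
qed

lemma tensor_power_permute:
  assumes "t \<in> tensor_power k U" "\<sigma> permutes {..<k}"
  shows "(\<lambda>xs. t (permute_list \<sigma> xs)) \<in> tensor_power k U"
proof (rule linear_on_tensor_power_image[OF _ _ subspace_tensor_power assms(1)])
  show "linear_on fscale (tensor_power k U) (\<lambda>t xs. t (permute_list \<sigma> xs))"
    by (intro linear_onI ext) (simp_all add: pointwise)
  fix us :: "('a \<Rightarrow> complex) list" assume us: "length us = k" "set us \<subseteq> U"
  then show "(\<lambda>xs. pure us (permute_list \<sigma> xs)) \<in> tensor_power k U"
    unfolding pure_permute[OF us(1) assms(2)] using permutes_inv[OF assms(2)]
    by (intro pure_in_tensor_power) auto
qed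

lemma symmetrize_linear: "linear_on fscale U (symmetrize k)"
  by (intro linear_onI ext)
    (simp_all add: symmetrize_def pointwise sum.distrib add_divide_distrib sum_distrib_left)

lemma subspace_sym_power: "fn.subspace (sym_power k U)"
proof -
  have *: "((\<lambda>xs. t (permute_list \<sigma> xs)) = t) \<longleftrightarrow> (\<forall>xs. t (permute_list \<sigma> xs) = t xs)"
    for t :: "'a list \<Rightarrow> complex" and \<sigma> by (simp add: fun_eq_iff)
  show ?thesis
    using subspace_tensor_power[of k U] unfolding sym_power_def fn.subspace_def *
    by (auto simp: pointwise)
qed

lemma sym_power_subset: "sym_power k U \<subseteq> tensor_power k U"
  by (auto simp: sym_power_def)

lemma symmetrize_in_tensor_power:
  assumes t: "t \<in> tensor_power k U"
  shows "symmetrize k t \<in> tensor_power k U"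
proof -
  have "symmetrize k t = fscale (1 / fact k) (\<Sum>\<sigma> | \<sigma> permutes {..<k}. (\<lambda>xs. t (permute_list \<sigma> xs)))"
    by (rule ext) (simp add: symmetrize_def pointwise)
  also have "\<dots> \<in> tensor_power k U"
    using t by (intro fn.subspace_scale fn.subspace_sum subspace_tensor_power tensor_power_permute) auto
  finally show ?thesis .
qed

lemma symmetrize_in_sym_power:
  assumes t: "t \<in> tensor_power k U"
  shows "symmetrize k t \<in> sym_power k U"
  unfolding sym_power_def
proof (intro CollectI conjI allI impI ext symmetrize_in_tensor_power[OF t])
  fix \<tau> xs assume \<tau>: "\<tau> permutes {..<k}"
  show "symmetrize k t (permute_list \<tau> xs) = symmetrize k t xs"
  proof (cases "length xs = k")
    case True
    have "(\<Sum>\<sigma> | \<sigma> permutes {..<k}. t (permute_list \<sigma> (permute_list \<tau> xs))) =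
      (\<Sum>\<sigma> | \<sigma> permutes {..<k}. t (permute_list (\<tau> \<circ> \<sigma>) xs))"
      using True by (intro sum.cong) (auto simp: permute_list_compose)
    also have "\<dots> = (\<Sum>\<sigma> | \<sigma> permutes {..<k}. t (permute_list \<sigma> xs))"
      using \<tau> by (rule setum_permutations_compose_left[symmetric])
    finally show ?thesis by (simp add: symmetrize_def)
  next
    \<comment> \<open>At other lengths both sides are sums of zeros, since permuting preserves the
      length.\<close>
    case False
    then show ?thesis using tensor_power_length_neq[OF t] by (simp add: symmetrize_def)
  qed
qed

lemma symmetrize_sym_power:
  assumes "t \<in> sym_power k U"
  shows "symmetrize k t = t"
proof
  fix xs
  have "(\<Sum>\<sigma> | \<sigma> permutes {..<k}. t (permute_list \<sigma> xs)) = (\<Sum>\<sigma> | \<sigma> permutes {..<k}. t xs)"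
    using assms by (intro sum.cong) (auto simp: sym_power_def fun_eq_iff)
  also have "\<dots> = fact k * t xs" by (simp add: card_permutations)
  finally show "symmetrize k t xs = t xs" by (simp add: symmetrize_def)
qed

text \<open>Symmetrization is linear and fixes symmetric tensors, so it maps a spanning set of the
  tensor power to a spanning set.\<close>

lemma fin_dim_sym_power:
  assumes "fin_dim U"
  shows "fin_dim (sym_power k U)"
proof -
  from fin_dim_tensor_power[OF assms] obtain B where B: "finite B" "tensor_power k U = fn.span B"
    by (auto simp: fin_dim_def)
  have "sym_power k U \<subseteq> fn.span (symmetrize k ` B)"
  proof
    fix t assume t: "t \<in> sym_power k U"
    then have "t \<in> fn.span B" using sym_power_subset B by blast
    then have "symmetrize k t \<in> fn.span (symmetrize k ` B)"
      by (rule linear_on_span_image[OF symmetrize_linear _ fn.subspace_span, rotated]) (rule fn.span_base imageI)+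
    then show "t \<in> fn.span (symmetrize k ` B)" using symmetrize_sym_power[OF t] by simp
  qed
  moreover have "fn.span (symmetrize k ` B) \<subseteq> sym_power k U"
    using B(2) by (intro fn.span_minimal subspace_sym_power)
      (auto intro!: symmetrize_in_sym_power fn.span_base)
  ultimately show ?thesis using B(1) by (auto simp: fin_dim_def)
qed


section \<open>Polarization\<close>

lemma prod_sum_words:
  fixes a :: "nat \<Rightarrow> 'b \<Rightarrow> complex"
  shows "(\<Prod>l<N. \<Sum>j\<in>S. a l j) = (\<Sum>xs\<in>words S N. \<Prod>l<N. a l (xs ! l))"
proof (induction N arbitrary: a)
  case 0
  show ?case unfolding words_0 by simp
next
  case (Suc N)
  have "(\<Prod>l<Suc N. \<Sum>j\<in>S. a l j) = (\<Sum>j\<in>S. a 0 j) * (\<Prod>l<N. \<Sum>j\<in>S. a (Suc l) j)"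
    by (rule prod.lessThan_Suc_shift)
  also have "\<dots> = (\<Sum>x\<in>S. \<Sum>xs\<in>words S N. a 0 x * (\<Prod>l<N. a (Suc l) (xs ! l)))"
    unfolding Suc by (rule sum_product)
  also have "\<dots> = (\<Sum>xs\<in>words S (Suc N). \<Prod>l<Suc N. a l (xs ! l))"
    unfolding sum_words_Suc prod.lessThan_Suc_shift by simp
  finally show ?case .
qed

text \<open>Inclusion-exclusion: if some \<open>x\<close> in \<open>A\<close> lies outside
  \<open>R\<close>, adding or removing \<open>x\<close> pairs the sets above \<open>R\<close> with
  opposite signs.\<close>

lemma sum_signs_above:
  assumes "finite A" "R \<subseteq> A"
  shows "(\<Sum>S\<in>Pow A. if R \<subseteq> S then (-1) ^ (card A - card S) else 0) = (if R = A then 1 else (0::complex))"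
proof (cases "R = A")
  case True
  have "(\<Sum>S\<in>Pow A. if R \<subseteq> S then (-1) ^ (card A - card S) else (0::complex)) =
      (\<Sum>S\<in>Pow A. if S = A then 1 else 0)"
    using True by (intro sum.cong) auto
  then show ?thesis using True assms(1) by simp
next
  case False
  with assms(2) obtain x where x: "x \<in> A" "x \<notin> R" by blast
  define B where "B = A - {x}"
  have A: "A = insert x B" "x \<notin> B" "finite B" using x assms(1) by (auto simp: B_def)
  let ?h = "\<lambda>S. if R \<subseteq> S then (-1) ^ (card A - card S) else (0::complex)"
  have inj: "inj_on (insert x) (Pow B)" using A(2) by (auto simp: inj_on_def)
  have "sum ?h (Pow A) = sum ?h (Pow B) + sum ?h (insert x ` Pow B)"
    unfolding A(1) Pow_insert using A by (intro sum.union_disjoint) auto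
  also have "sum ?h (insert x ` Pow B) = (\<Sum>S\<in>Pow B. - ?h S)"
    unfolding sum.reindex[OF inj] o_def
  proof (rule sum.cong[OF refl])
    fix S assume S: "S \<in> Pow B"
    then have fin: "finite S" and xS: "x \<notin> S" and le: "card S \<le> card B"
      using A finite_subset card_mono by auto
    then have "card A - card S = Suc (card A - card (insert x S))"
      using A by simp
    then show "?h (insert x S) = - ?h S" using x(2) by auto
  qed
  finally show ?thesis using False by (simp add: sum_negf)
qed

text \<open>A word of length \<open>N\<close> using all \<open>N\<close> letters has no repetitions,
  hence lists the values of a permutation.\<close>

lemma sum_full_words_permutes:
  fixes h :: "nat list \<Rightarrow> complex"
  shows "(\<Sum>xs | length xs = N \<and> set xs = {..<N}. h xs) =
    (\<Sum>\<sigma> | \<sigma> permutes {..<N}. h (map \<sigma> [0..<N]))"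
proof -
  have "bij_betw (\<lambda>\<sigma>. map \<sigma> [0..<N]) {\<sigma>. \<sigma> permutes {..<N}}
      {xs. length xs = N \<and> set xs = {..<N}}"
    unfolding bij_betw_def
  proof
    show "inj_on (\<lambda>\<sigma>. map \<sigma> [0..<N]) {\<sigma>. \<sigma> permutes {..<N}}"
    proof (rule inj_onI)
      fix \<sigma> \<tau> assume *: "\<sigma> \<in> {\<sigma>. \<sigma> permutes {..<N}}" "\<tau> \<in> {\<sigma>. \<sigma> permutes {..<N}}"
        "map \<sigma> [0..<N] = map \<tau> [0..<N]"
      show "\<sigma> = \<tau>"
      proof
        fix j show "\<sigma> j = \<tau> j"
          using * by (cases "j < N") (auto simp: permutes_def)
      qed
    qed
    show "(\<lambda>\<sigma>. map \<sigma> [0..<N]) ` {\<sigma>. \<sigma> permutes {..<N}} = {xs. length xs = N \<and> set xs = {..<N}}"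
    proof (intro equalityI subsetI)
      fix xs assume "xs \<in> (\<lambda>\<sigma>. map \<sigma> [0..<N]) ` {\<sigma>. \<sigma> permutes {..<N}}"
      then obtain \<sigma> where \<sigma>: "\<sigma> permutes {..<N}" and xs: "xs = map \<sigma> [0..<N]" by auto
      have "set xs = \<sigma> ` {..<N}" by (auto simp: xs)
      then show "xs \<in> {xs. length xs = N \<and> set xs = {..<N}}"
        using permutes_image[OF \<sigma>] by (simp add: xs)
    next
      fix xs assume "xs \<in> {xs. length xs = N \<and> set xs = {..<N}}"
      then have xs: "length xs = N" "set xs = {..<N}" by auto
      define \<sigma> where "\<sigma> = (\<lambda>j. if j < N then xs ! j else j)"
      have "distinct xs" using xs by (intro card_distinct) auto
      then have inj: "inj_on \<sigma> {..<N}"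
        using xs by (auto simp: inj_on_def \<sigma>_def nth_eq_iff_index_eq)
      have "\<sigma> ` {..<N} = {..<N}"
        using xs by (auto simp: \<sigma>_def set_conv_nth image_iff)
      with inj have "\<sigma> permutes {..<N}"
        by (intro bij_imp_permutes) (auto simp: bij_betw_def \<sigma>_def)
      moreover have "xs = map \<sigma> [0..<N]"
        using xs by (intro nth_equalityI) (auto simp: \<sigma>_def)
      ultimately show "xs \<in> (\<lambda>\<sigma>. map \<sigma> [0..<N]) ` {\<sigma>. \<sigma> permutes {..<N}}" by blast
    qed
  qed
  from sum.reindex_bij_betw[OF this, of h] show ?thesis by simp
qed

text \<open>Ryser's formula for the permanent. After expanding the products, a word contributes to
  every \<open>S\<close> containing its letters, and the signs cancel unless the word uses all
  letters.\<close>

lemma ryser: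
  fixes a :: "nat \<Rightarrow> nat \<Rightarrow> complex"
  shows "(\<Sum>S\<in>Pow {..<N}. (-1) ^ (N - card S) * (\<Prod>l<N. \<Sum>j\<in>S. a l j)) =
    (\<Sum>\<sigma> | \<sigma> permutes {..<N}. \<Prod>l<N. a l (\<sigma> l))"
proof -
  let ?W = "words {..<N} N" and ?p = "\<lambda>xs. \<Prod>l<N. a l (xs ! l)"
  let ?sg = "\<lambda>S. (-1) ^ (N - card S) :: complex"
  have fin: "finite ?W" by (rule finite_words) simp
  have "(\<Sum>S\<in>Pow {..<N}. ?sg S * (\<Prod>l<N. \<Sum>j\<in>S. a l j)) =
      (\<Sum>S\<in>Pow {..<N}. \<Sum>xs\<in>?W. (if set xs \<subseteq> S then ?sg S else 0) * ?p xs)"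
  proof (rule sum.cong[OF refl])
    fix S assume "S \<in> Pow {..<N}"
    then have "words S N = {xs \<in> ?W. set xs \<subseteq> S}" by auto
    then have "(\<Prod>l<N. \<Sum>j\<in>S. a l j) = (\<Sum>xs\<in>?W. if set xs \<subseteq> S then ?p xs else 0)"
      unfolding prod_sum_words using sum.inter_filter[OF fin] by simp
    then show "?sg S * (\<Prod>l<N. \<Sum>j\<in>S. a l j) =
        (\<Sum>xs\<in>?W. (if set xs \<subseteq> S then ?sg S else 0) * ?p xs)"
      by (simp only: sum_distrib_left) (intro sum.cong, auto)
  qed
  also have "\<dots> = (\<Sum>xs\<in>?W. (\<Sum>S\<in>Pow {..<N}. if set xs \<subseteq> S then ?sg S else 0) * ?p xs)"
    by (subst sum.swap) (simp only: sum_distrib_right)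
  also have "\<dots> = (\<Sum>xs\<in>?W. if set xs = {..<N} then ?p xs else 0)"
  proof (rule sum.cong[OF refl])
    fix xs assume "xs \<in> ?W"
    then have "set xs \<subseteq> {..<N}" by simp
    then have "(\<Sum>S\<in>Pow {..<N}. if set xs \<subseteq> S then ?sg S else 0) = (if set xs = {..<N} then 1 else 0)"
      using sum_signs_above[of "{..<N}" "set xs"] unfolding card_lessThan by blast
    then show "(\<Sum>S\<in>Pow {..<N}. if set xs \<subseteq> S then ?sg S else 0) * ?p xs =
        (if set xs = {..<N} then ?p xs else 0)" by simp
  qed
  also have "\<dots> = (\<Sum>xs | length xs = N \<and> set xs = {..<N}. ?p xs)"
  proof -
    have "{xs \<in> ?W. set xs = {..<N}} = {xs. length xs = N \<and> set xs = {..<N}}" by auto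
    then show ?thesis using sum.inter_filter[OF fin, of ?p "\<lambda>xs. set xs = {..<N}"] by simp
  qed
  also have "\<dots> = (\<Sum>\<sigma> | \<sigma> permutes {..<N}. \<Prod>l<N. a l (\<sigma> l))"
    unfolding sum_full_words_permutes by simp
  finally show ?thesis .
qed

lemma pure_replicate:
  "pure (replicate N u) xs = (if length xs = N then \<Prod>l<N. u (xs ! l) else 0)"
  by (simp add: pure_def)

text \<open>The polarization identity: at each word \<open>xs\<close> of length \<open>N\<close> the
  symmetrization is a permanent divided by \<open>fact N\<close>, to which \<open>ryser\<close>
  applies. It reduces questions about linear maps on symmetric tensors to powers of single
  vectors.\<close>

lemma symmetrize_pure:
  assumes "length us = N"
  shows "symmetrize N (pure us) = (\<Sum>S\<in>Pow {..<N}.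
    fscale ((-1) ^ (N - card S) / fact N) (pure (replicate N (\<Sum>j\<in>S. us ! j))))"
proof
  fix xs
  show "symmetrize N (pure us) xs = (\<Sum>S\<in>Pow {..<N}.
    fscale ((-1) ^ (N - card S) / fact N) (pure (replicate N (\<Sum>j\<in>S. us ! j)))) xs"
  proof (cases "length xs = N")
    case True
    have "pure us (permute_list \<sigma> xs) = (\<Prod>l<N. (us ! inv_into UNIV \<sigma> l) (xs ! l))"
      if "\<sigma> permutes {..<N}" for \<sigma>
      using fun_cong[OF pure_permute[OF assms that], of xs] assms True permutes_inv[OF that]
      by (simp add: pure_def permute_list_nth)
    then have "symmetrize N (pure us) xs =
        (\<Sum>\<sigma> | \<sigma> permutes {..<N}. \<Prod>l<N. (us ! inv_into UNIV \<sigma> l) (xs ! l)) / fact N"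
      by (simp add: symmetrize_def)
    \<comment> \<open>Inversion is a bijection of the index set, so the sum over inverses is the sum
      over all permutations.\<close>
    also have "\<dots> = (\<Sum>\<sigma> | \<sigma> permutes {..<N}. \<Prod>l<N. (us ! \<sigma> l) (xs ! l)) / fact N"
      using sum_permutations_inverse[of "\<lambda>\<sigma>. \<Prod>l<N. (us ! \<sigma> l) (xs ! l)" "{..<N}"] by simp
    also have "\<dots> = (\<Sum>S\<in>Pow {..<N}. (-1) ^ (N - card S) * (\<Prod>l<N. \<Sum>j\<in>S. (us ! j) (xs ! l))) / fact N"
      using ryser[of N "\<lambda>l j. (us ! j) (xs ! l)"] by simp
    finally show ?thesis using True
      by (simp add: pointwise pure_replicate sum_divide_distrib)
  next
    case False
    then show ?thesis using assms by (simp add: symmetrize_def pointwise pure_replicate pure_length_neq)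
  qed
qed


section \<open>The pairing of tensors with tensors of functionals\<close>

abbreviation pairing :: "nat \<Rightarrow> ('x \<Rightarrow> complex) set \<Rightarrow> (('x \<Rightarrow> complex) list \<Rightarrow> complex) \<Rightarrow>
    ('x list \<Rightarrow> complex) \<Rightarrow> complex" where
  "pairing k U F \<equiv> tensor_lift (*) k U F"

lemma pairing_linear_right:
  "fin_dim U \<Longrightarrow> F \<in> tensor_power k (dual U) \<Longrightarrow>
    linear_on (*) (tensor_power k U) (pairing k U F)"
  by (rule tensor_lift_linear[OF vector_space_mult _ multilin_tensor_power_dual])

lemma pairing_pure:
  "fin_dim U \<Longrightarrow> F \<in> tensor_power k (dual U) \<Longrightarrow> length us = k \<Longrightarrow> set us \<subseteq> U \<Longrightarrow>
    pairing k U F (pure us) = F us"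
  by (rule tensor_lift_pure[OF vector_space_mult _ multilin_tensor_power_dual])

lemma pairing_eqI:
  assumes "fin_dim U" "F \<in> tensor_power k (dual U)" "linear_on (*) (tensor_power k U) f"
    and "\<And>us. length us = k \<Longrightarrow> set us \<subseteq> U \<Longrightarrow> F us = f (pure us)"
    and "t \<in> tensor_power k U"
  shows "pairing k U F t = f t"
  by (rule linear_on_tensor_power_eqI[OF vector_space_mult pairing_linear_right[OF assms(1,2)] assms(3) _ assms(5)])
    (simp add: pairing_pure assms)

lemma pairing_linear_left:
  assumes U: "fin_dim U" and t: "t \<in> tensor_power k U"
  shows "linear_on (*) (tensor_power k (dual U)) (\<lambda>F. pairing k U F t)"
proof (rule linear_onI)
  note sub = subspace_tensor_power[of k "dual U"]
  fix F G c assume F: "F \<in> tensor_power k (dual U)"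
  note linF = pairing_linear_right[OF U F]
  show "pairing k U (fscale c F) t = c * pairing k U F t"
  proof (rule pairing_eqI[OF U fn.subspace_scale[OF sub F] _ _ t])
    show "linear_on (*) (tensor_power k U) (\<lambda>t. c * pairing k U F t)"
      by (intro linear_onI) (simp_all add: linear_on_add[OF linF] linear_on_scale[OF linF] algebra_simps)
  qed (simp add: pairing_pure[OF U F] fscale_apply)
  assume G: "G \<in> tensor_power k (dual U)"
  note linG = pairing_linear_right[OF U G]
  show "pairing k U (F + G) t = pairing k U F t + pairing k U G t"
  proof (rule pairing_eqI[OF U fn.subspace_add[OF sub F G] _ _ t])
    show "linear_on (*) (tensor_power k U) (\<lambda>t. pairing k U F t + pairing k U G t)"
      by (intro linear_onI) (simp_all add: linear_on_add[OF linF] linear_on_scale[OF linF]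
          linear_on_add[OF linG] linear_on_scale[OF linG] algebra_simps)
  qed (simp add: pairing_pure[OF U F] pairing_pure[OF U G] plus_fun_apply)
qed

text \<open>Checked on pure tensors, where a product of evaluations multiplies the values of the
  factors. Pairings therefore recover all coordinates of a tensor.\<close>

lemma pairing_evaluation:
  assumes U: "fin_dim U" and t: "t \<in> tensor_power k U" and ys: "length ys = k"
  shows "pairing k U (pure (map (evaluation U) ys)) t = t ys"
proof (rule pairing_eqI[OF U _ _ _ t])
  show "pure (map (evaluation U) ys) \<in> tensor_power k (dual U)"
    using ys evaluation_in_dual[OF fin_dim_subspace[OF U]] by (intro pure_in_tensor_power) auto
  show "linear_on (*) (tensor_power k U) (\<lambda>t. t ys)"
    by (intro linear_onI) (simp_all add: pointwise)
  fix us :: "('a \<Rightarrow> complex) list" assume us: "length us = k" "set us \<subseteq> U"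
  then have "us ! j \<in> U" if "j < k" for j using that by (metis nth_mem subset_iff)
  then show "pure (map (evaluation U) ys) us = pure us ys"
    using us ys by (simp add: pure_def evaluation_def)
qed

text \<open>Coordinates are pairings with products of evaluations, and by linearity in the
  functionals, products from any spanning set \<open>G\<close> of the dual suffice. Later
  \<open>G\<close> consists of \<open>m\<close>-th powers.\<close>

lemma tensor_eqI:
  assumes U: "fin_dim U" and t: "t \<in> tensor_power k U" "t' \<in> tensor_power k U"
    and G: "dual U = fn.span G"
    and eq: "\<And>fs. length fs = k \<Longrightarrow> set fs \<subseteq> G \<Longrightarrow> pairing k U (pure fs) t = pairing k U (pure fs) t'"
  shows "t = t'"
proof
  fix ys
  show "t ys = t' ys"
  proof (cases "length ys = k")
    case True
    have mem: "pure (map (evaluation U) ys) \<in> tensor_power k (dual U)"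
      using True evaluation_in_dual[OF fin_dim_subspace[OF U]] by (intro pure_in_tensor_power) auto
    have T: "tensor_power k (dual U) = fn.span (pure ` words G k)"
      unfolding G by (rule tensor_power_span)
    have "pairing k U (pure (map (evaluation U) ys)) t = pairing k U (pure (map (evaluation U) ys)) t'"
    proof (rule linear_on_span_eqI[OF vector_space_mult pairing_linear_left[OF U t(1), unfolded T]
          pairing_linear_left[OF U t(2), unfolded T] _ mem[unfolded T]])
      fix F assume "F \<in> pure ` words G k"
      then obtain fs where "length fs = k" "set fs \<subseteq> G" "F = pure fs" by blast
      then show "pairing k U F t = pairing k U F t'" using eq by simp
    qed
    then show ?thesis using True by (simp add: pairing_evaluation U t)
  next
    case False
    then show ?thesis using tensor_power_length_neq[OF t(1)] tensor_power_length_neq[OF t(2)] by simp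
  qed
qed

text \<open>Finite dimension makes every functional on the dual side a pairing: the representing
  tensor takes the values of \<open>\<Gamma>\<close> on products of evaluations as its
  coefficients.\<close>

lemma functional_representation:
  assumes U: "fin_dim U" and \<Gamma>: "linear_on (*) (tensor_power k (dual U)) \<Gamma>"
  shows "\<exists>t\<in>tensor_power k U. \<forall>F\<in>tensor_power k (dual U). pairing k U F t = \<Gamma> F"
proof -
  note sub = fin_dim_subspace[OF U]
  obtain X b where X: "finite X" "b ` X \<subseteq> U"
    and interp: "\<And>u. u \<in> U \<Longrightarrow> u = (\<Sum>x\<in>X. fscale (u x) (b x))"
    using fin_dim_interpolation[OF U] by blast
  let ?e = "evaluation U"
  define t where "t = (\<Sum>xs\<in>words X k. fscale (\<Gamma> (pure (map ?e xs))) (pure (map b xs)))"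
  have mem: "pure (map b xs) \<in> tensor_power k U" if "xs \<in> words X k" for xs
    using that X(2) by (intro pure_in_tensor_power) auto
  have mem': "pure (map ?e xs) \<in> tensor_power k (dual U)" if "xs \<in> words X k" for xs
    using that evaluation_in_dual[OF sub] by (intro pure_in_tensor_power) auto
  have t: "t \<in> tensor_power k U"
    unfolding t_def using mem by (intro fn.subspace_sum fn.subspace_scale subspace_tensor_power)
  have "pairing k U F t = \<Gamma> F" if F: "F \<in> tensor_power k (dual U)" for F
  proof (rule linear_on_tensor_power_eqI[OF vector_space_mult pairing_linear_left[OF U t] \<Gamma> _ F])
    fix fs :: "(('a \<Rightarrow> complex) \<Rightarrow> complex) list"
    assume fs: "length fs = k" "set fs \<subseteq> dual U"
    have pfs: "pure fs \<in> tensor_power k (dual U)" using fs by (rule pure_in_tensor_power)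
    have "pairing k U (pure fs) t =
        (\<Sum>xs\<in>words X k. \<Gamma> (pure (map ?e xs)) * pairing k U (pure fs) (pure (map b xs)))"
      unfolding t_def using mem
      by (intro linear_on_sum[OF vector_space_mult pairing_linear_right[OF U pfs] subspace_tensor_power])
    also have "\<dots> = (\<Sum>xs\<in>words X k. (\<Prod>j<k. (fs ! j) (b (xs ! j))) * \<Gamma> (pure (map ?e xs)))"
    proof (rule sum.cong[OF refl])
      fix xs assume xs: "xs \<in> words X k"
      then have "pairing k U (pure fs) (pure (map b xs)) = pure fs (map b xs)"
        using X(2) by (intro pairing_pure[OF U pfs]) auto
      then show "\<Gamma> (pure (map ?e xs)) * pairing k U (pure fs) (pure (map b xs)) =
          (\<Prod>j<k. (fs ! j) (b (xs ! j))) * \<Gamma> (pure (map ?e xs))"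
        using xs fs by (simp add: pure_def)
    qed
    also have "\<dots> = \<Gamma> (\<Sum>xs\<in>words X k. fscale (\<Prod>j<k. (fs ! j) (b (xs ! j))) (pure (map ?e xs)))"
      using mem' by (intro linear_on_sum[OF vector_space_mult \<Gamma> subspace_tensor_power, symmetric])
    also have "(\<Sum>xs\<in>words X k. fscale (\<Prod>j<k. (fs ! j) (b (xs ! j))) (pure (map ?e xs))) = pure fs"
    proof (rule multilin_expand[OF vector_space_fscale subspace_dual[OF sub] X(1) _ multilin_pure fs,
          symmetric])
      show "?e ` X \<subseteq> dual U" using evaluation_in_dual[OF sub] by auto
      fix f assume "f \<in> set fs"
      with fs have f: "f \<in> dual U" by auto
      show "f = (\<Sum>x\<in>X. fscale (f (b x)) (?e x))"
        by (rule dual_interpolation[OF sub X _ f]) (rule interp)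
    qed
    finally show "pairing k U (pure fs) t = \<Gamma> (pure fs)" .
  qed
  with t show ?thesis by blast
qed

text \<open>Permuting vectors and functionals simultaneously only reorders the factors of each
  product.\<close>

lemma pairing_permute:
  assumes U: "fin_dim U" and F: "F \<in> tensor_power k (dual U)" and t: "t \<in> tensor_power k U"
    and \<sigma>: "\<sigma> permutes {..<k}"
  shows "pairing k U (\<lambda>us. F (permute_list \<sigma> us)) (\<lambda>xs. t (permute_list \<sigma> xs)) = pairing k U F t"
proof (rule linear_on_tensor_power_eqI[OF vector_space_mult _ pairing_linear_right[OF U F] _ t,
      where f = "\<lambda>t. pairing k U (\<lambda>us. F (permute_list \<sigma> us)) (\<lambda>xs. t (permute_list \<sigma> xs))"])
  let ?F = "\<lambda>us. F (permute_list \<sigma> us)"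
  have F': "?F \<in> tensor_power k (dual U)" by (rule tensor_power_permute[OF F \<sigma>])
  have "linear_on fscale (tensor_power k U) (\<lambda>t xs. t (permute_list \<sigma> xs))"
    by (intro linear_onI ext) (simp_all add: pointwise)
  then show "linear_on (*) (tensor_power k U) (\<lambda>t. pairing k U ?F (\<lambda>xs. t (permute_list \<sigma> xs)))"
    using pairing_linear_right[OF U F'] tensor_power_permute[OF _ \<sigma>]
    by (intro linear_on_compose[where f = "\<lambda>t xs. t (permute_list \<sigma> xs)" and g = "pairing k U ?F"]) auto
  fix us :: "('a \<Rightarrow> complex) list" assume us: "length us = k" "set us \<subseteq> U"
  have "pairing k U ?F (pure (permute_list (inv_into UNIV \<sigma>) us)) = ?F (permute_list (inv_into UNIV \<sigma>) us)"
    using us permutes_inv[OF \<sigma>] by (intro pairing_pure[OF U F']) auto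
  also have "\<dots> = F us"
    using us \<sigma> by (simp add: permute_list_compose[symmetric] permutes_inv_o)
  finally show "pairing k U ?F (\<lambda>xs. pure us (permute_list \<sigma> xs)) = pairing k U F (pure us)"
    using us by (simp add: pure_permute[OF us(1) \<sigma>] pairing_pure[OF U F])
qed

text \<open>By \<open>pairing_permute\<close> and the symmetry of \<open>t\<close>, every permuted
  copy of \<open>F\<close> in the average pairs to the same value.\<close>

lemma pairing_symmetrize:
  assumes U: "fin_dim U" and F: "F \<in> tensor_power k (dual U)" and t: "t \<in> sym_power k U"
  shows "pairing k U (symmetrize k F) t = pairing k U F t"
proof -
  let ?P = "{\<sigma>. \<sigma> permutes {..<k}}"
  have t': "t \<in> tensor_power k U" using t sym_power_subset by blast
  have "symmetrize k F = (\<Sum>\<sigma>\<in>?P. fscale (1 / fact k) (\<lambda>us. F (permute_list \<sigma> us)))"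
    by (rule ext) (simp add: symmetrize_def pointwise sum_divide_distrib)
  then have "pairing k U (symmetrize k F) t =
      pairing k U (\<Sum>\<sigma>\<in>?P. fscale (1 / fact k) (\<lambda>us. F (permute_list \<sigma> us))) t" by simp
  also have "\<dots> = (\<Sum>\<sigma>\<in>?P. 1 / fact k * pairing k U (\<lambda>us. F (permute_list \<sigma> us)) t)"
    using tensor_power_permute[OF F]
    by (intro linear_on_sum[OF vector_space_mult pairing_linear_left[OF U t'] subspace_tensor_power]) auto
  also have "\<dots> = (\<Sum>\<sigma>\<in>?P. 1 / fact k * pairing k U F t)"
  proof (rule sum.cong[OF refl])
    fix \<sigma> assume "\<sigma> \<in> ?P"
    then have \<sigma>: "\<sigma> permutes {..<k}" by simp
    with t have "(\<lambda>xs. t (permute_list \<sigma> xs)) = t" by (simp add: sym_power_def)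
    with pairing_permute[OF U F t' \<sigma>]
    show "1 / fact k * pairing k U (\<lambda>us. F (permute_list \<sigma> us)) t = 1 / fact k * pairing k U F t" by simp
  qed
  also have "\<dots> = pairing k U F t" by (simp add: card_permutations)
  finally show ?thesis .
qed

text \<open>Resolves the definite description in \<open>gamma\<close>, whose body has the shape of
  \<open>t0\<close>. Invariance of \<open>\<Gamma>\<close> forces the representing tensor to be
  symmetric; uniqueness holds because a symmetric tensor pairs with \<open>F\<close> as with its
  symmetrization. The second conclusion covers all \<open>F\<close> in the tensor power, so that
  products of distinct powers can be inserted directly.\<close>

lemma symmetric_functional_representation:
  assumes U: "fin_dim U" and \<Gamma>: "linear_on (*) (tensor_power k (dual U)) \<Gamma>"
    and inv: "\<And>F \<sigma>. F \<in> tensor_power k (dual U) \<Longrightarrow> \<sigma> permutes {..<k} \<Longrightarrow>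
      \<Gamma> (\<lambda>us. F (permute_list \<sigma> us)) = \<Gamma> F"
  defines "t0 \<equiv> (THE t. t \<in> sym_power k U \<and>
      (\<forall>F \<in> sym_power k (dual U). dual_ident k U F t = \<Gamma> F))"
  shows "t0 \<in> sym_power k U" and "F \<in> tensor_power k (dual U) \<Longrightarrow> pairing k U F t0 = \<Gamma> F"
proof -
  obtain t where t: "t \<in> tensor_power k U"
    and rep: "\<And>F. F \<in> tensor_power k (dual U) \<Longrightarrow> pairing k U F t = \<Gamma> F"
    using functional_representation[OF U \<Gamma>] by blast
  have G: "dual U = fn.span (dual U)"
    by (rule fn.span_eq_iff[THEN iffD2, OF subspace_dual[OF fin_dim_subspace[OF U]], symmetric])
  have sym: "t \<in> sym_power k U"
    unfolding sym_power_def
  proof (intro CollectI conjI allI impI t)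
    fix \<sigma> assume \<sigma>: "\<sigma> permutes {..<k}"
    note \<sigma>' = permutes_inv[OF \<sigma>]
    show "(\<lambda>xs. t (permute_list \<sigma> xs)) = t"
    proof (rule tensor_eqI[OF U tensor_power_permute[OF t \<sigma>] t G])
      fix fs :: "(('a \<Rightarrow> complex) \<Rightarrow> complex) list"
      assume fs: "length fs = k" "set fs \<subseteq> dual U"
      \<comment> \<open>Chosen so that permuting the arguments of \<open>F\<close> gives back
        \<open>pure fs\<close>: the inverse in \<open>pure_permute\<close> cancels
        \<open>\<sigma>\<close>.\<close>
      define F where "F = pure (permute_list \<sigma> fs)"
      have F: "F \<in> tensor_power k (dual U)"
        unfolding F_def using fs \<sigma> by (intro pure_in_tensor_power) auto
      have F': "(\<lambda>us. F (permute_list \<sigma> us)) = pure fs"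
        unfolding F_def using fs \<sigma>
        by (subst pure_permute[of _ k]) (simp_all add: permute_list_compose[symmetric] \<sigma>' permutes_inv_o)
      have "pairing k U (pure fs) (\<lambda>xs. t (permute_list \<sigma> xs)) = pairing k U F t"
        using pairing_permute[OF U F t \<sigma>] by (simp add: F')
      also have "\<dots> = pairing k U (pure fs) t"
        using inv[OF F \<sigma>] rep[OF F] rep[OF pure_in_tensor_power[OF fs]] by (simp add: F')
      finally show "pairing k U (pure fs) (\<lambda>xs. t (permute_list \<sigma> xs)) = pairing k U (pure fs) t" .
    qed
  qed
  have "t0 = t"
    unfolding t0_def
  proof (rule the_equality)
    show "t \<in> sym_power k U \<and> (\<forall>F \<in> sym_power k (dual U). dual_ident k U F t = \<Gamma> F)"
      using sym rep sym_power_subset[of k "dual U"] by (auto simp: dual_ident_def)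
  next
    fix t' assume t': "t' \<in> sym_power k U \<and> (\<forall>F \<in> sym_power k (dual U). dual_ident k U F t' = \<Gamma> F)"
    then have sym': "t' \<in> sym_power k U" by blast
    show "t' = t"
    proof (rule tensor_eqI[OF U _ t G])
      show "t' \<in> tensor_power k U" using sym' sym_power_subset by blast
      fix fs :: "(('a \<Rightarrow> complex) \<Rightarrow> complex) list"
      assume fs: "length fs = k" "set fs \<subseteq> dual U"
      have F: "pure fs \<in> tensor_power k (dual U)" using fs by (rule pure_in_tensor_power)
      note F' = symmetrize_in_sym_power[OF F]
      have "pairing k U (pure fs) t' = dual_ident k U (symmetrize k (pure fs)) t'"
        using pairing_symmetrize[OF U F sym'] sym' by (simp add: dual_ident_def)
      also have "\<dots> = \<Gamma> (symmetrize k (pure fs))" using t' F' by blast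
      also have "\<dots> = pairing k U (pure fs) t"
        using rep F' sym_power_subset pairing_symmetrize[OF U F sym] by (metis subsetD)
      finally show "pairing k U (pure fs) t' = pairing k U (pure fs) t" .
    qed
  qed
  then show "t0 \<in> sym_power k U" and "F \<in> tensor_power k (dual U) \<Longrightarrow> pairing k U F t0 = \<Gamma> F"
    using sym rep by auto
qed


section \<open>Powers of functionals\<close>

text \<open>The \<open>m\<close>-th power of \<open>\<xi>\<close> as a functional on
  \<open>S^m(E)\<close>, as in the Veronese embedding; \<open>dual_ident\<close> supplies the
  restriction to symmetric tensors.\<close>

definition veronese :: "nat \<Rightarrow> ('x \<Rightarrow> complex) set \<Rightarrow> (('x \<Rightarrow> complex) \<Rightarrow> complex) \<Rightarrow>
    ('x list \<Rightarrow> complex) \<Rightarrow> complex" where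
  "veronese m E \<xi> = dual_ident m E (pure (replicate m \<xi>))"

lemma pure_replicate_in_sym_power:
  assumes "u \<in> U"
  shows "pure (replicate k u) \<in> sym_power k U"
  unfolding sym_power_def
proof (intro CollectI conjI allI impI)
  show "pure (replicate k u) \<in> tensor_power k U"
    using assms by (intro pure_in_tensor_power) auto
  fix \<sigma> assume \<sigma>: "\<sigma> permutes {..<k}"
  have "inv_into UNIV \<sigma> j < k" if "j < k" for j
    using permutes_in_image[OF permutes_inv[OF \<sigma>], of j] that by simp
  then have "permute_list (inv_into UNIV \<sigma>) (replicate k u) = replicate k u"
    using permutes_inv[OF \<sigma>] by (intro nth_equalityI) (auto simp: permute_list_nth)
  then show "(\<lambda>xs. pure (replicate k u) (permute_list \<sigma> xs)) = pure (replicate k u)"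
    by (simp add: pure_permute[OF _ \<sigma>])
qed

lemma pairing_symmetrize_right:
  assumes U: "fin_dim U" and F: "F \<in> sym_power k (dual U)" and t: "t \<in> tensor_power k U"
  shows "pairing k U F (symmetrize k t) = pairing k U F t"
proof -
  let ?P = "{\<sigma>. \<sigma> permutes {..<k}}"
  have F': "F \<in> tensor_power k (dual U)" using F sym_power_subset by blast
  have "symmetrize k t = (\<Sum>\<sigma>\<in>?P. fscale (1 / fact k) (\<lambda>xs. t (permute_list \<sigma> xs)))"
    by (rule ext) (simp add: symmetrize_def pointwise sum_divide_distrib)
  then have "pairing k U F (symmetrize k t) =
      pairing k U F (\<Sum>\<sigma>\<in>?P. fscale (1 / fact k) (\<lambda>xs. t (permute_list \<sigma> xs)))" by simp
  also have "\<dots> = (\<Sum>\<sigma>\<in>?P. 1 / fact k * pairing k U F (\<lambda>xs. t (permute_list \<sigma> xs)))"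
    using tensor_power_permute[OF t]
    by (intro linear_on_sum[OF vector_space_mult pairing_linear_right[OF U F'] subspace_tensor_power]) auto
  also have "\<dots> = (\<Sum>\<sigma>\<in>?P. 1 / fact k * pairing k U F t)"
  proof (rule sum.cong[OF refl])
    fix \<sigma> assume "\<sigma> \<in> ?P"
    then have \<sigma>: "\<sigma> permutes {..<k}" by simp
    with F have "(\<lambda>us. F (permute_list \<sigma> us)) = F" by (simp add: sym_power_def)
    with pairing_permute[OF U F' t \<sigma>]
    show "1 / fact k * pairing k U F (\<lambda>xs. t (permute_list \<sigma> xs)) = 1 / fact k * pairing k U F t" by simp
  qed
  also have "\<dots> = pairing k U F t" by (simp add: card_permutations)
  finally show ?thesis .
qed

lemma pure_replicate_dual:
  assumes "\<xi> \<in> dual E"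
  shows "pure (replicate m \<xi>) \<in> tensor_power m (dual E)"
  using pure_replicate_in_sym_power[OF assms] sym_power_subset by blast

lemma veronese_eq:
  "w \<in> sym_power m E \<Longrightarrow> veronese m E \<xi> w = pairing m E (pure (replicate m \<xi>)) w"
  by (simp add: veronese_def dual_ident_def)

lemma veronese_in_dual:
  assumes "fin_dim E" "\<xi> \<in> dual E"
  shows "veronese m E \<xi> \<in> dual (sym_power m E)"
  unfolding veronese_def dual_ident_def
  by (rule restrict_in_dual[OF subspace_sym_power linear_on_mono[OF _ sym_power_subset]])
    (rule pairing_linear_right[OF assms(1) pure_replicate_dual[OF assms(2)]])

text \<open>A power of a single functional is a symmetric tensor, so symmetrizing the other side
  does not change the pairing.\<close>

lemma veronese_symmetrize_pure:
  assumes E: "fin_dim E" and \<xi>: "\<xi> \<in> dual E" and us: "length us = m" "set us \<subseteq> E"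
  shows "veronese m E \<xi> (symmetrize m (pure us)) = (\<Prod>j<m. \<xi> (us ! j))"
proof -
  have t: "pure us \<in> tensor_power m E" using us by (rule pure_in_tensor_power)
  show ?thesis
    using us by (simp add: veronese_eq symmetrize_in_sym_power[OF t] pure_replicate
        pairing_symmetrize_right[OF E pure_replicate_in_sym_power[OF \<xi>] t]
        pairing_pure[OF E pure_replicate_dual[OF \<xi>]])
qed

text \<open>By polarization, evaluation at a point is a combination of \<open>m\<close>-th powers.\<close>

lemma dual_sym_power_eq_span:
  assumes E: "fin_dim E"
  shows "dual (sym_power m E) = fn.span (veronese m E ` dual E)"
proof
  let ?W = "sym_power m E" and ?V = "fn.span (veronese m E ` dual E)"
  show "?V \<subseteq> dual ?W"
    using veronese_in_dual[OF E] by (intro fn.span_minimal subspace_dual subspace_sym_power) auto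
  have ev: "evaluation ?W ys \<in> ?V" for ys
  proof (cases "length ys = m")
    case True
    let ?us = "map (evaluation E) ys"
    let ?c = "\<lambda>S. (-1) ^ (m - card S) / fact m" and ?\<xi> = "\<lambda>S. \<Sum>j\<in>S. ?us ! j"
    have us: "length ?us = m" "set ?us \<subseteq> dual E"
      using True evaluation_in_dual[OF fin_dim_subspace[OF E]] by auto
    have \<xi>: "?\<xi> S \<in> dual E" if S: "S \<in> Pow {..<m}" for S
    proof (rule fn.subspace_sum[OF subspace_dual[OF fin_dim_subspace[OF E]]])
      fix j assume "j \<in> S"
      with S us(1) have "j < length ?us" by auto
      with us(2) show "?us ! j \<in> dual E" by (meson nth_mem subsetD)
    qed
    have "evaluation ?W ys = (\<Sum>S\<in>Pow {..<m}. fscale (?c S) (veronese m E (?\<xi> S)))"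
    proof
      fix w
      show "evaluation ?W ys w = (\<Sum>S\<in>Pow {..<m}. fscale (?c S) (veronese m E (?\<xi> S))) w"
      proof (cases "w \<in> ?W")
        case w: True
        then have w': "w \<in> tensor_power m E" using sym_power_subset by blast
        have "w ys = pairing m E (pure ?us) w" using pairing_evaluation[OF E w' True] by simp
        also have "\<dots> = pairing m E (symmetrize m (pure ?us)) w"
          using pairing_symmetrize[OF E pure_in_tensor_power[OF us] w] by simp
        also have "\<dots> = (\<Sum>S\<in>Pow {..<m}. ?c S * pairing m E (pure (replicate m (?\<xi> S))) w)"
          unfolding symmetrize_pure[OF us(1)]
          by (rule linear_on_sum[OF vector_space_mult pairing_linear_left[OF E w'] subspace_tensor_power])
            (rule pure_replicate_dual[OF \<xi>])
        finally show ?thesis using w by (simp add: evaluation_def pointwise veronese_eq)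
      next
        case False
        then show ?thesis by (simp add: evaluation_def pointwise veronese_def dual_ident_def)
      qed
    qed
    also have "\<dots> \<in> ?V"
      by (intro fn.span_sum fn.span_scale fn.span_base imageI \<xi>)
    finally show ?thesis .
  next
    case False
    \<comment> \<open>Tensors vanish on lists of the wrong length, so here the evaluation is the
      zero functional.\<close>
    have "evaluation ?W ys u = 0" for u
      using sym_power_subset[of m E] tensor_power_length_neq[of u m E ys] False
      by (auto simp: evaluation_def)
    then have "evaluation ?W ys = 0" by (simp add: fun_eq_iff zero_fun_apply)
    then show ?thesis by (simp add: fn.span_zero)
  qed
  note W = fin_dim_sym_power[OF E, of m]
  obtain X b where X: "finite X" "b ` X \<subseteq> ?W"
    and interp: "\<And>u. u \<in> ?W \<Longrightarrow> u = (\<Sum>x\<in>X. fscale (u x) (b x))"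
    using fin_dim_interpolation[OF W] by blast
  show "dual ?W \<subseteq> ?V"
  proof
    fix f assume f: "f \<in> dual ?W"
    have "f = (\<Sum>x\<in>X. fscale (f (b x)) (evaluation ?W x))"
      by (rule dual_interpolation[OF fin_dim_subspace[OF W] X _ f]) (rule interp)
    also have "\<dots> \<in> ?V" by (intro fn.span_sum fn.span_scale ev)
    finally show "f \<in> ?V" .
  qed
qed


section \<open>The functional of a power of the determinant\<close>

lemma pure_mat_unit:
  "pure (map mat_unit ps) qs = (if qs = ps then 1 else 0)"
proof (cases "length qs = length ps")
  case True
  show ?thesis
  proof (cases "qs = ps")
    case False
    with True obtain j where "j < length ps" "qs ! j \<noteq> ps ! j"
      by (auto simp: list_eq_iff_nth_eq)
    then show ?thesis using True False by (auto simp: pure_def mat_unit_def)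
  qed (simp add: pure_def mat_unit_def)
qed (auto simp: pure_def)

lemma fin_dim_mat_space: "fin_dim (mat_space i)"
proof -
  let ?I = "{..<i} \<times> {..<i}"
  have sub: "fn.subspace (mat_space i)"
    by (auto simp: fn.subspace_def mat_space_def pointwise)
  have "A \<in> fn.span (mat_unit ` ?I)" if A: "A \<in> mat_space i" for A
  proof -
    have "A = (\<Sum>p\<in>?I. fscale (A p) (mat_unit p))"
    proof
      fix q
      have "(\<Sum>p\<in>?I. fscale (A p) (mat_unit p)) q = (\<Sum>p\<in>?I. if q = p then A p else 0)"
        unfolding sum_fun_apply by (intro sum.cong) (auto simp: pointwise mat_unit_def)
      also have "\<dots> = (if q \<in> ?I then A q else 0)"
        by (rule sum.delta') simp
      finally show "A q = (\<Sum>p\<in>?I. fscale (A p) (mat_unit p)) q"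
        using A[unfolded mat_space_def, THEN CollectD, rule_format, of q] by (simp split: if_splits)
    qed
    also have "\<dots> \<in> fn.span (mat_unit ` ?I)"
      by (intro fn.span_sum fn.span_scale fn.span_base imageI)
    finally show ?thesis .
  qed
  moreover have "fn.span (mat_unit ` ?I) \<subseteq> mat_space i"
    by (intro fn.span_minimal sub) (auto simp: mat_space_def mat_unit_def)
  ultimately have "mat_space i = fn.span (mat_unit ` ?I)" by blast
  then show ?thesis by (simp add: fin_dim_span)
qed

text \<open>Products of matrix units are the indicator functions of single words, so membership is
  merely a condition on the support.\<close>

lemma tensor_power_mat_spaceI:
  assumes "\<And>ps. \<not> (length ps = N \<and> set ps \<subseteq> {..<i} \<times> {..<i}) \<Longrightarrow> t ps = 0"
  shows "t \<in> tensor_power N (mat_space i)"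
proof -
  let ?W = "words ({..<i} \<times> {..<i}) N"
  have fin: "finite ?W" by (rule finite_words) simp
  have "t = (\<Sum>ps\<in>?W. fscale (t ps) (pure (map mat_unit ps)))"
  proof
    fix qs
    have "(\<Sum>ps\<in>?W. fscale (t ps) (pure (map mat_unit ps))) qs = (\<Sum>ps\<in>?W. if qs = ps then t ps else 0)"
      unfolding sum_fun_apply by (intro sum.cong) (auto simp: pointwise pure_mat_unit)
    also have "\<dots> = (if qs \<in> ?W then t qs else 0)" by (rule sum.delta'[OF fin])
    also have "\<dots> = t qs" using assms[of qs] by auto
    finally show "t qs = (\<Sum>ps\<in>?W. fscale (t ps) (pure (map mat_unit ps))) qs" by simp
  qed
  also have "\<dots> \<in> tensor_power N (mat_space i)"
  proof (intro fn.subspace_sum fn.subspace_scale subspace_tensor_power)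
    fix ps assume "ps \<in> ?W"
    then show "pure (map mat_unit ps) \<in> tensor_power N (mat_space i)"
      by (intro pure_in_tensor_power) (auto simp: mat_space_def mat_unit_def)
  qed
  finally show ?thesis .
qed

lemma prod_list_map_nth: "prod_list (map f xs) = (\<Prod>l<length xs. f (xs ! l) :: complex)"
  by (induction xs) (simp_all add: prod.lessThan_Suc_shift del: prod.lessThan_Suc)

lemma prod_list_concat: "prod_list (concat xss) = prod_list (map prod_list xss)"
  for xss :: "complex list list"
  by (induction xss) auto

text \<open>Expanding \<open>(det A)^n\<close> into monomials expresses it by coordinates of \<open>A \<otimes> \<dots> \<otimes> A\<close>.\<close>

lemma det_power_functional_exists:
  "\<exists>d. linear_on (*) (sym_power (i * n) (mat_space i)) d \<and>
    (\<forall>A\<in>mat_space i. d (pure (replicate (i * n) A)) = det (mat i i A) ^ n)"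
proof -
  let ?P = "{\<sigma>. \<sigma> permutes {..<i}}"
  \<comment> \<open>\<open>path\<close> lists the index pairs visited by \<open>n\<close> successive
    permutations. The coordinate of a power of \<open>A\<close> at this word is the product of the
    corresponding Leibniz monomials.\<close>
  define path where "path = (\<lambda>\<sigma>s. concat (map (\<lambda>\<sigma>. map (\<lambda>r. (r, \<sigma> r :: nat)) [0..<i]) \<sigma>s))"
  define d where "d = (\<lambda>t. \<Sum>\<sigma>s\<in>words ?P n. (\<Prod>l<n. signof (\<sigma>s ! l)) * (t (path \<sigma>s) :: complex))"
  have "d (pure (replicate (i * n) A)) = det (mat i i A) ^ n" for A
  proof -
    let ?a = "\<lambda>\<sigma>. signof \<sigma> * (\<Prod>r<i. A (r, \<sigma> r))"
    have "d (pure (replicate (i * n) A)) = (\<Sum>\<sigma>s\<in>words ?P n. \<Prod>l<n. ?a (\<sigma>s ! l))"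
      unfolding d_def
    proof (rule sum.cong[OF refl])
      fix \<sigma>s assume "\<sigma>s \<in> words ?P n"
      then have len: "length \<sigma>s = n" by simp
      have lp: "length (path \<sigma>s) = i * n"
        by (simp add: path_def length_concat o_def sum_list_triv len)
      have "pure (replicate (i * n) A) (path \<sigma>s) = prod_list (map A (path \<sigma>s))"
        unfolding pure_replicate prod_list_map_nth lp by simp
      also have "\<dots> = (\<Prod>l<n. \<Prod>r<i. A (r, (\<sigma>s ! l) r))"
        by (simp add: path_def map_concat prod_list_concat o_def prod_list_map_nth len)
      finally show "(\<Prod>l<n. signof (\<sigma>s ! l)) * pure (replicate (i * n) A) (path \<sigma>s) =
          (\<Prod>l<n. ?a (\<sigma>s ! l))"
        by (simp add: prod.distrib)
    qed
    also have "\<dots> = (\<Prod>l<n. \<Sum>\<sigma>\<in>?P. ?a \<sigma>)"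
      by (rule prod_sum_words[symmetric])
    also have "(\<Sum>\<sigma>\<in>?P. ?a \<sigma>) = det (mat i i A)"
    proof -
      have "det (mat i i A) = (\<Sum>\<sigma> | \<sigma> permutes {0..<i}. signof \<sigma> * (\<Prod>r = 0..<i. mat i i A $$ (r, \<sigma> r)))"
        by (rule det_def') simp
      also have "\<dots> = (\<Sum>\<sigma>\<in>?P. ?a \<sigma>)"
        unfolding atLeast0LessThan
      proof (rule sum.cong[OF refl])
        fix \<sigma> assume "\<sigma> \<in> ?P"
        then have "\<sigma> r < i" if "r < i" for r using that permutes_in_image[of \<sigma> "{..<i}" r] by simp
        then show "signof \<sigma> * (\<Prod>r<i. mat i i A $$ (r, \<sigma> r)) = ?a \<sigma>" by simp
      qed
      finally show ?thesis by simp
    qed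
    finally show ?thesis by simp
  qed
  moreover have "linear_on (*) (sym_power (i * n) (mat_space i)) d"
    by (intro linear_onI)
      (simp_all add: d_def pointwise algebra_simps sum.distrib sum_distrib_left)
  ultimately show ?thesis by blast
qed

lemma sum_in_mat_space:
  assumes "length us = N" "set us \<subseteq> mat_space i" "S \<in> Pow {..<N}"
  shows "(\<Sum>j\<in>S. us ! j) \<in> mat_space i"
proof (rule fn.subspace_sum[OF fin_dim_subspace[OF fin_dim_mat_space]])
  fix j assume "j \<in> S"
  with assms have "j < length us" by auto
  with assms(2) show "us ! j \<in> mat_space i" by (meson nth_mem subsetD)
qed

text \<open>Existence comes from the Leibniz expansion, uniqueness from polarization: powers of
  single matrices span the symmetric tensors.\<close>

lemma det_functional_characterization:
  "det_functional n i \<in> dual (sym_power (i * n) (mat_space i)) \<and>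
    (\<forall>A\<in>mat_space i. det_functional n i (pure (replicate (i * n) A)) = det (mat i i A) ^ n)"
proof -
  let ?N = "i * n" and ?M = "mat_space i"
  let ?S = "sym_power ?N ?M"
  let ?P = "\<lambda>d. d \<in> dual ?S \<and> (\<forall>A\<in>?M. d (pure (replicate ?N A)) = det (mat i i A) ^ n)"
  obtain d where d: "linear_on (*) ?S d" "\<And>A. A \<in> ?M \<Longrightarrow> d (pure (replicate ?N A)) = det (mat i i A) ^ n"
    using det_power_functional_exists[of i n] by blast
  have "?P (\<lambda>t. if t \<in> ?S then d t else 0)"
    using restrict_in_dual[OF subspace_sym_power d(1)] by (simp add: pure_replicate_in_sym_power d(2))
  moreover have "d1 = d2" if d1: "?P d1" and d2: "?P d2" for d1 d2
  proof
    fix t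
    show "d1 t = d2 t"
    proof (cases "t \<in> ?S")
      case False
      then show ?thesis
        using dual_outside[OF conjunct1[OF d1] False] dual_outside[OF conjunct1[OF d2] False] by simp
    next
      case True
      then have t: "t \<in> tensor_power ?N ?M" using sym_power_subset by blast
      have lin: "linear_on (*) (tensor_power ?N ?M) (\<lambda>t. f (symmetrize ?N t))" if "f \<in> dual ?S" for f
        using symmetrize_in_sym_power
        by (intro linear_on_compose[where f = "symmetrize ?N" and g = f and V = ?S, OF
              symmetrize_linear dual_linear[OF that]]) auto
      \<comment> \<open>A symmetric tensor equals its symmetrization. Comparing after symmetrizing
        permits the reduction to pure tensors, which need not be symmetric themselves.\<close>
      have "d1 (symmetrize ?N t) = d2 (symmetrize ?N t)"
      proof (rule linear_on_tensor_power_eqI[OF vector_space_mult lin lin _ t])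
        show "d1 \<in> dual ?S" "d2 \<in> dual ?S" using d1 d2 by auto
        fix us assume us: "length us = ?N" "set us \<subseteq> ?M"
        note mem = sum_in_mat_space[OF us]
        have *: "f (symmetrize ?N (pure us)) = (\<Sum>S\<in>Pow {..<?N}.
            ((-1) ^ (?N - card S) / fact ?N) * det (mat i i (\<Sum>j\<in>S. us ! j)) ^ n)" if f: "?P f" for f
        proof -
          have "f (symmetrize ?N (pure us)) = (\<Sum>S\<in>Pow {..<?N}.
            ((-1) ^ (?N - card S) / fact ?N) * f (pure (replicate ?N (\<Sum>j\<in>S. us ! j))))"
            unfolding symmetrize_pure[OF us(1)]
            by (rule linear_on_sum[OF vector_space_mult dual_linear[OF conjunct1[OF f]] subspace_sym_power])
              (rule pure_replicate_in_sym_power[OF mem])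
          also have "\<dots> = (\<Sum>S\<in>Pow {..<?N}.
            ((-1) ^ (?N - card S) / fact ?N) * det (mat i i (\<Sum>j\<in>S. us ! j)) ^ n)"
            by (rule sum.cong[OF refl]) (simp only: bspec[OF conjunct2[OF f] mem])
          finally show ?thesis .
        qed
        show "d1 (symmetrize ?N (pure us)) = d2 (symmetrize ?N (pure us))"
          using *[OF d1] *[OF d2] by simp
      qed
      then show ?thesis by (simp add: symmetrize_sym_power[OF True])
    qed
  qed
  ultimately have "\<exists>!d. ?P d" by blast
  from theI'[OF this] show ?thesis unfolding det_functional_def .
qed

text \<open>Polarization makes the functional computable on products of arbitrary matrices, although
  it is specified only on powers.\<close>

lemma det_functional_symmetrize_pure:
  assumes us: "length us = i * n" "set us \<subseteq> mat_space i"
  shows "det_functional n i (symmetrize (i * n) (pure us)) = (\<Sum>S\<in>Pow {..<i * n}.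
    ((-1) ^ (i * n - card S) / fact (i * n)) * det (mat i i (\<Sum>j\<in>S. us ! j)) ^ n)"
proof -
  let ?d = "det_functional n i"
  note d = det_functional_characterization[of n i]
  note mem = sum_in_mat_space[OF us]
  have "?d (symmetrize (i * n) (pure us)) = (\<Sum>S\<in>Pow {..<i * n}.
      ((-1) ^ (i * n - card S) / fact (i * n)) * ?d (pure (replicate (i * n) (\<Sum>j\<in>S. us ! j))))"
    unfolding symmetrize_pure[OF us(1)]
    by (rule linear_on_sum[OF vector_space_mult dual_linear[OF conjunct1[OF d]] subspace_sym_power])
      (rule pure_replicate_in_sym_power[OF mem])
  also have "\<dots> = (\<Sum>S\<in>Pow {..<i * n}.
      ((-1) ^ (i * n - card S) / fact (i * n)) * det (mat i i (\<Sum>j\<in>S. us ! j)) ^ n)"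
    by (rule sum.cong[OF refl]) (simp only: bspec[OF conjunct2[OF d] mem])
  finally show ?thesis .
qed

section \<open>Determinants of combinations of rank one matrices\<close>

lemma det_scale_rows:
  fixes c :: "nat \<Rightarrow> complex"
  shows "det (mat n n (\<lambda>(l, q). c l * x l q)) = (\<Prod>l<n. c l) * det (mat n n (\<lambda>(l, q). x l q))"
proof -
  have "det (mat n n (\<lambda>(l, q). c l * x l q)) =
    (\<Sum>p | p permutes {0..<n}. signof p * (\<Prod>r = 0..<n. mat n n (\<lambda>(l, q). c l * x l q) $$ (r, p r)))"
    by (rule det_def') simp
  \<comment> \<open>Each Leibniz term takes one entry from every row, hence every \<open>c l\<close>
    exactly once.\<close>
  also have "\<dots> = (\<Sum>p | p permutes {0..<n}. (\<Prod>l<n. c l) *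
      (signof p * (\<Prod>r = 0..<n. mat n n (\<lambda>(l, q). x l q) $$ (r, p r))))"
  proof (rule sum.cong[OF refl])
    fix p assume "p \<in> {p. p permutes {0..<n}}"
    then have "p r < n" if "r < n" for r using that permutes_in_image[of p "{0..<n}" r] by simp
    then show "signof p * (\<Prod>r = 0..<n. mat n n (\<lambda>(l, q). c l * x l q) $$ (r, p r)) =
        (\<Prod>l<n. c l) * (signof p * (\<Prod>r = 0..<n. mat n n (\<lambda>(l, q). x l q) $$ (r, p r)))"
      by (simp add: prod.distrib atLeast0LessThan)
  qed
  also have "\<dots> = (\<Prod>l<n. c l) * det (mat n n (\<lambda>(l, q). x l q))"
    by (subst det_def'[of _ n]) (simp_all add: sum_distrib_left)
  finally show ?thesis .
qed

text \<open>The matrix factors as the transpose of \<open>?X\<close> times the matrix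
  \<open>?X\<close> with rows scaled by \<open>c\<close>.\<close>

lemma det_gram:
  fixes x :: "nat \<Rightarrow> nat \<Rightarrow> complex"
  shows "det (mat n n (\<lambda>(p, q). \<Sum>l<n. c l * (x l p * x l q))) =
    (\<Prod>l<n. c l) * det (mat n n (\<lambda>(l, q). x l q)) ^ 2"
proof -
  let ?X = "mat n n (\<lambda>(l, q). x l q)" and ?Y = "mat n n (\<lambda>(l, q). c l * x l q)"
  have X: "?X \<in> carrier_mat n n" and Y: "?Y \<in> carrier_mat n n" by auto
  have "mat n n (\<lambda>(p, q). \<Sum>l<n. c l * (x l p * x l q)) = transpose_mat ?X * ?Y"
    by (rule eq_matI) (auto simp: scalar_prod_def atLeast0LessThan algebra_simps)
  then have "det (mat n n (\<lambda>(p, q). \<Sum>l<n. c l * (x l p * x l q))) = det (transpose_mat ?X) * det ?Y"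
    using det_mult[OF transpose_carrier_mat[THEN iffD2, OF X] Y] by simp
  then show ?thesis
    using det_transpose[OF X] by (simp add: det_scale_rows power2_eq_square)
qed


section \<open>The values of the functional on powers\<close>

lemma Theta_apply:
  "Theta n i e f ps = (if length ps = n \<and> set ps \<subseteq> {..<i} \<times> {..<i}
    then f (pure (concat (map (\<lambda>(j, k). [e j, e k]) ps))) else 0)"
proof -
  let ?W = "words ({..<i} \<times> {..<i}) n"
  let ?f = "\<lambda>ps. f (pure (concat (map (\<lambda>(j, k). [e j, e k]) ps)))"
  have fin: "finite ?W" by (rule finite_words) simp
  have "Theta n i e f ps = (\<Sum>qs\<in>?W. if ps = qs then ?f qs else 0)"
    unfolding Theta_def sum_fun_apply by (intro sum.cong) (auto simp: pointwise pure_mat_unit)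
  also have "\<dots> = (if ps \<in> ?W then ?f ps else 0)" by (rule sum.delta'[OF fin])
  finally show ?thesis by simp
qed

lemma Theta_pi_dual_linear: "linear_on fscale V (Theta n i e \<circ> pi_dual m E)"
  by (intro linear_onI ext) (simp_all add: Theta_apply pi_dual_def pointwise)

lemma flatten_linear: "linear_on fscale V (flatten k n)"
  by (intro linear_onI ext) (simp_all add: flatten_def pointwise)

text \<open>\<open>det_functional\<close> is zero off its domain by convention, so its linearity is
  usable only once the flattened tensors are known to lie in the tensor power that symmetrization
  maps into that domain.\<close>

lemma flatten_Theta_in_tensor_power:
  assumes W: "fin_dim V" and F: "F \<in> tensor_power i V"
  shows "flatten i n (tensor_map i V (Theta n i e \<circ> pi_dual m E) F) \<in> tensor_power (i * n) (mat_space i)"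
proof (rule linear_on_tensor_power_image[OF _ _ subspace_tensor_power F])
  let ?L = "Theta n i e \<circ> pi_dual m E"
  note L = Theta_pi_dual_linear[of V n i e m E]
  show "linear_on fscale (tensor_power i V) (\<lambda>F. flatten i n (tensor_map i V ?L F))"
    by (rule linear_on_compose[OF tensor_map_linear[OF W L] flatten_linear[of UNIV]]) simp
  fix fs assume fs: "length fs = i" "set fs \<subseteq> V"
  show "flatten i n (tensor_map i V ?L (pure fs)) \<in> tensor_power (i * n) (mat_space i)"
    unfolding tensor_map_pure[OF W L fs]
  proof (rule tensor_power_mat_spaceI)
    fix ps :: "(nat \<times> nat) list"
    assume not: "\<not> (length ps = i * n \<and> set ps \<subseteq> {..<i} \<times> {..<i})"
    show "flatten i n (pure (map ?L fs)) ps = 0"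
    proof (cases "length ps = i * n")
      case True
      with not obtain p where p: "p < i * n" "ps ! p \<notin> {..<i} \<times> {..<i}"
        by (metis in_set_conv_nth subsetI)
      then have n: "n > 0" by (cases n) auto
      \<comment> \<open>The inadmissible index pair sits in block \<open>p div n\<close> at place
        \<open>p mod n\<close>. The factor belonging to that block is a value of
        \<open>Theta\<close>, which vanishes on such a word.\<close>
      have j: "p div n < i" using p(1) n by (simp add: div_less_iff_less_mult)
      let ?block = "take n (drop (p div n * n) ps)"
      have "p div n * n + n \<le> i * n"
        using mult_le_mono1[of "Suc (p div n)" i n] j by simp
      then have len: "length ?block = n" using True by simp
      have "p div n * n \<le> length ps"
        unfolding True using \<open>p div n * n + n \<le> i * n\<close> by (rule add_leD1)
      then have "?block ! (p mod n) = ps ! p" using n by simp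
      moreover have "?block ! (p mod n) \<in> set ?block" using n len by (intro nth_mem) simp
      ultimately have "\<not> set ?block \<subseteq> {..<i} \<times> {..<i}" using p(2) by auto
      then have "?L (fs ! (p div n)) ?block = 0" by (simp add: Theta_apply)
      then have "\<exists>j<i. ?L (fs ! j) (take n (drop (j * n) ps)) = 0" using j by blast
      then show ?thesis
        using True fs by (auto simp: flatten_def pure_def prod_zero_iff)
    qed (simp add: flatten_def)
  qed
qed

lemma gamma_functional_linear:
  assumes E: "fin_dim E"
  shows "linear_on (*) (tensor_power i (dual (sym_power m E))) (gamma_functional m i E e)"
proof -
  let ?V = "dual (sym_power m E)" and ?n = "m div 2"
  let ?L = "Theta ?n i e \<circ> pi_dual m E"
  let ?N = "i * ?n"
  have V: "fin_dim ?V" by (intro fin_dim_dual fin_dim_sym_power E)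
  have 1: "linear_on fscale (tensor_power i ?V) (\<lambda>F. flatten i ?n (tensor_map i ?V ?L F))"
    by (rule linear_on_compose[OF tensor_map_linear[OF V Theta_pi_dual_linear] flatten_linear[of UNIV]]) simp
  have 2: "linear_on fscale (tensor_power i ?V) (\<lambda>F. symmetrize ?N (flatten i ?n (tensor_map i ?V ?L F)))"
    by (rule linear_on_compose[OF 1 symmetrize_linear[of UNIV]]) simp
  have "linear_on (*) (tensor_power i ?V)
      (\<lambda>F. det_functional ?n i (symmetrize ?N (flatten i ?n (tensor_map i ?V ?L F))))"
  proof (rule linear_on_compose[OF 2 dual_linear[OF conjunct1[OF det_functional_characterization]]])
    show "(\<lambda>F. symmetrize ?N (flatten i ?n (tensor_map i ?V ?L F))) ` tensor_power i ?V
        \<subseteq> sym_power ?N (mat_space i)"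
      using symmetrize_in_sym_power[OF flatten_Theta_in_tensor_power[OF V]] by blast
  qed
  then show ?thesis by (simp add: gamma_functional_def[abs_def])
qed

definition rank_one :: "nat \<Rightarrow> (nat \<Rightarrow> 'x) \<Rightarrow> ('x \<Rightarrow> complex) \<Rightarrow> nat \<times> nat \<Rightarrow> complex" where
  "rank_one i e \<xi> = (\<lambda>(j, k). if j < i \<and> k < i then \<xi> (e j) * \<xi> (e k) else 0)"

lemma rank_one_in_mat_space: "rank_one i e \<xi> \<in> mat_space i"
  by (auto simp: rank_one_def mat_space_def)

text \<open>The coefficient at a word of index pairs is a product of \<open>\<xi>\<close> over
  \<open>2 * n\<close> basis vectors. Since \<open>Theta\<close> groups neighbouring factors, it
  regroups into entries of the rank one matrix.\<close>

lemma Theta_veronese: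
  assumes E: "fin_dim E" and \<xi>: "\<xi> \<in> dual E" and e: "\<And>j. j < i \<Longrightarrow> e j \<in> E"
  shows "(Theta n i e \<circ> pi_dual (2 * n) E) (veronese (2 * n) E \<xi>) = pure (replicate n (rank_one i e \<xi>))"
proof
  fix ps
  show "(Theta n i e \<circ> pi_dual (2 * n) E) (veronese (2 * n) E \<xi>) ps = pure (replicate n (rank_one i e \<xi>)) ps"
  proof (cases "length ps = n")
    case len: True
    have pr: "pure (replicate n (rank_one i e \<xi>)) ps = (\<Prod>l<length ps. rank_one i e \<xi> (ps ! l))"
      using len by (simp add: pure_replicate)
    show ?thesis
    proof (cases "set ps \<subseteq> {..<i} \<times> {..<i}")
      case True
      let ?us = "concat (map (\<lambda>(j, k). [e j, e k]) ps)"
      have us: "length ?us = 2 * n" "set ?us \<subseteq> E"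
        using True len e
        by (auto simp: length_concat o_def case_prod_unfold sum_list_triv)
      have "(Theta n i e \<circ> pi_dual (2 * n) E) (veronese (2 * n) E \<xi>) ps =
          veronese (2 * n) E \<xi> (symmetrize (2 * n) (pure ?us))"
        using True len us by (simp add: Theta_apply pi_dual_def pure_in_tensor_power)
      also have "\<dots> = (\<Prod>j<length ?us. \<xi> (?us ! j))"
        unfolding veronese_symmetrize_pure[OF E \<xi> us] us(1) by (rule refl)
      also have "\<dots> = prod_list (map (\<lambda>p. \<xi> (e (fst p)) * \<xi> (e (snd p))) ps)"
        unfolding prod_list_map_nth[symmetric]
        by (simp add: map_concat prod_list_concat o_def case_prod_unfold)
      also have "map (\<lambda>p. \<xi> (e (fst p)) * \<xi> (e (snd p))) ps = map (rank_one i e \<xi>) ps"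
        using True by (intro map_cong) (auto simp: rank_one_def)
      finally show ?thesis unfolding pr prod_list_map_nth .
    next
      case False
      \<comment> \<open>One inadmissible pair makes an entry, hence the whole product, vanish, in
        agreement with \<open>Theta\<close>.\<close>
      then obtain l where "l < length ps" "ps ! l \<notin> {..<i} \<times> {..<i}"
        by (metis in_set_conv_nth subsetI)
      then have "l < length ps" "rank_one i e \<xi> (ps ! l) = 0"
        using rank_one_in_mat_space[of i e \<xi>] unfolding mat_space_def by blast+
      then have "\<exists>l<length ps. rank_one i e \<xi> (ps ! l) = 0" by blast
      then have "pure (replicate n (rank_one i e \<xi>)) ps = 0"
        unfolding pr by (auto simp: prod_zero_iff)
      then show ?thesis using False by (simp add: Theta_apply)
    qed
  qed (simp add: Theta_apply pure_replicate)
qed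

text \<open>Position \<open>p\<close> of the concatenated word lies in block \<open>p div n\<close>,
  so the product over all positions can be taken block by block.\<close>

lemma flatten_pure_replicate:
  assumes len: "length As = i"
  shows "flatten i n (pure (map (\<lambda>A. pure (replicate n A)) As)) = pure (map (\<lambda>p. As ! (p div n)) [0..<i * n])"
proof
  fix xs
  show "flatten i n (pure (map (\<lambda>A. pure (replicate n A)) As)) xs =
      pure (map (\<lambda>p. As ! (p div n)) [0..<i * n]) xs"
  proof (cases "length xs = i * n")
    case True
    have "flatten i n (pure (map (\<lambda>A. pure (replicate n A)) As)) xs =
        (\<Prod>j<i. pure (replicate n (As ! j)) (take n (drop (j * n) xs)))"
      using True len by (simp add: flatten_def pure_def)
    also have "\<dots> = (\<Prod>j<i. \<Prod>p = j * n..<j * n + n. (As ! (p div n)) (xs ! p))"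
    proof (rule prod.cong[OF refl])
      fix j assume "j \<in> {..<i}"
      then have "j * n + n \<le> i * n" using mult_le_mono1[of "Suc j" i n] by simp
      then have "length (take n (drop (j * n) xs)) = n" using True by simp
      then have "pure (replicate n (As ! j)) (take n (drop (j * n) xs)) = (\<Prod>r<n. (As ! j) (xs ! (j * n + r)))"
      proof -
        have "j * n \<le> length xs"
          unfolding True using \<open>j * n + n \<le> i * n\<close> by (rule add_leD1)
        then show ?thesis
          using \<open>length (take n (drop (j * n) xs)) = n\<close> by (simp add: pure_replicate)
      qed
      also have "\<dots> = (\<Prod>r<n. (As ! ((j * n + r) div n)) (xs ! (j * n + r)))"
        by (intro prod.cong) auto
      also have "\<dots> = (\<Prod>p = j * n..<j * n + n. (As ! (p div n)) (xs ! p))"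
        by (simp add: prod.atLeastLessThan_shift_0[of _ "j * n"] atLeast0LessThan add.commute)
      finally show "pure (replicate n (As ! j)) (take n (drop (j * n) xs)) =
          (\<Prod>p = j * n..<j * n + n. (As ! (p div n)) (xs ! p))" .
    qed
    also have "\<dots> = (\<Prod>p<i * n. (As ! (p div n)) (xs ! p))" by (rule prod.nat_group)
    finally show ?thesis using True by (simp add: pure_def)
  qed (simp add: flatten_def pure_def)
qed

text \<open>The permanent of the block diagonal matrix with \<open>i\<close> diagonal blocks, each
  the \<open>n\<close> by \<open>n\<close> matrix of ones; it counts the permutations that preserve
  every block.\<close>

definition block_permanent :: "nat \<Rightarrow> nat \<Rightarrow> complex" where
  "block_permanent n i =
    (\<Sum>\<sigma> | \<sigma> permutes {..<i * n}. \<Prod>p<i * n. if \<sigma> p div n = p div n then 1 else 0)"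

text \<open>The summands are nonnegative integers and the identity contributes \<open>1\<close>.
  Passing to natural numbers makes the order available.\<close>

lemma block_permanent_nonzero: "block_permanent n i \<noteq> 0"
proof -
  let ?P = "{\<sigma>. \<sigma> permutes {..<i * n}}"
  let ?f = "\<lambda>\<sigma>. \<Prod>p<i * n. if \<sigma> p div n = p div n then 1 else 0 :: nat"
  have "block_permanent n i = of_nat (\<Sum>\<sigma>\<in>?P. ?f \<sigma>)"
    unfolding block_permanent_def of_nat_sum of_nat_prod by (intro sum.cong prod.cong refl) simp
  moreover have "?f id \<le> (\<Sum>\<sigma>\<in>?P. ?f \<sigma>)"
    by (rule member_le_sum) (simp_all add: permutes_id finite_permutations del: id_apply)
  then have "(\<Sum>\<sigma>\<in>?P. ?f \<sigma>) \<noteq> 0" by simp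
  ultimately show ?thesis by (simp only: of_nat_eq_0_iff not_False_eq_True)
qed

text \<open>The polarized determinant sums over sets \<open>S\<close> of positions. The matrices at
  the positions in \<open>S\<close> add up to a combination of the rank one matrices in which the
  \<open>l\<close>-th has as weight the number of positions of \<open>S\<close> in block
  \<open>l\<close>. By \<open>det_gram\<close> the determinant power splits into a product of
  weights and \<open>?D ^ m\<close>, and Ryser's formula turns the alternating sum of the weight
  products into \<open>block_permanent\<close>.\<close>

lemma gamma_functional_veronese:
  assumes m: "even m" and E: "fin_dim E" and \<xi>s: "length \<xi>s = i" "set \<xi>s \<subseteq> dual E"
    and e: "\<And>j. j < i \<Longrightarrow> e j \<in> E"
  shows "gamma_functional m i E e (pure (map (veronese m E) \<xi>s)) =
    block_permanent (m div 2) i / fact (i * (m div 2)) * det (mat i i (\<lambda>(l, q). (\<xi>s ! l) (e q))) ^ m"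
proof -
  let ?n = "m div 2"
  let ?N = "i * ?n"
  let ?V = "dual (sym_power m E)"
  let ?L = "Theta ?n i e \<circ> pi_dual m E"
  let ?D = "det (mat i i (\<lambda>(l, q). (\<xi>s ! l) (e q)))"
  let ?Bs = "map (\<lambda>p. map (rank_one i e) \<xi>s ! (p div ?n)) [0..<?N]"
  have m2: "2 * ?n = m" using m by simp
  have V: "fin_dim ?V" by (intro fin_dim_dual fin_dim_sym_power E)
  have mem: "set (map (veronese m E) \<xi>s) \<subseteq> ?V"
    using \<xi>s(2) veronese_in_dual[OF E] by auto
  have "tensor_map i ?V ?L (pure (map (veronese m E) \<xi>s)) = pure (map ?L (map (veronese m E) \<xi>s))"
    using \<xi>s(1) mem by (intro tensor_map_pure V Theta_pi_dual_linear) simp_all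
  also have "map ?L (map (veronese m E) \<xi>s) = map (\<lambda>A. pure (replicate ?n A)) (map (rank_one i e) \<xi>s)"
  proof -
    have "?L (veronese m E \<xi>) = pure (replicate ?n (rank_one i e \<xi>))" if "\<xi> \<in> set \<xi>s" for \<xi>
    proof -
      have "\<xi> \<in> dual E" using that \<xi>s(2) by blast
      then have "(Theta ?n i e \<circ> pi_dual (2 * ?n) E) (veronese (2 * ?n) E \<xi>) =
          pure (replicate ?n (rank_one i e \<xi>))"
        by (rule Theta_veronese[OF E]) (rule e)
      then show ?thesis by (simp only: m2)
    qed
    then show ?thesis by simp
  qed
  finally have flat: "flatten i ?n (tensor_map i ?V ?L (pure (map (veronese m E) \<xi>s))) = pure ?Bs"
    using \<xi>s(1) by (simp only: flatten_pure_replicate length_map)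
  \<comment> \<open>If \<open>?n = 0\<close> there are no positions, so division by zero does not
    matter.\<close>
  have div: "p div ?n < i" if "p < ?N" for p
    using that by (cases "?n = 0") (simp_all add: div_less_iff_less_mult)
  have Bs: "length ?Bs = ?N" "set ?Bs \<subseteq> mat_space i"
    using \<xi>s(1) div by (auto simp: rank_one_in_mat_space)
  have det: "det (mat i i (\<Sum>j\<in>S. ?Bs ! j)) ^ ?n =
      (\<Prod>p<?N. \<Sum>j\<in>S. if j div ?n = p div ?n then 1 else 0) * ?D ^ m" if S: "S \<in> Pow {..<?N}" for S
  proof -
    let ?s = "\<lambda>l. \<Sum>j\<in>S. if j div ?n = l then 1 else 0 :: complex"
    let ?x = "\<lambda>l q. (\<xi>s ! l) (e q)"
    have finS: "finite S" using S finite_subset by auto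
    have entry: "(\<Sum>j\<in>S. ?Bs ! j) (p, q) = (\<Sum>l<i. ?s l * (?x l p * ?x l q))" if "p < i" "q < i" for p q
    proof -
      have "(\<Sum>j\<in>S. ?Bs ! j) (p, q) = (\<Sum>j\<in>S. ?x (j div ?n) p * ?x (j div ?n) q)"
        unfolding sum_fun_apply
      proof (rule sum.cong[OF refl])
        fix j assume "j \<in> S"
        with S have "j < ?N" by auto
        then show "(?Bs ! j) (p, q) = ?x (j div ?n) p * ?x (j div ?n) q"
          using that \<xi>s(1) div[OF \<open>j < ?N\<close>] by (simp add: rank_one_def)
      qed
      also have "\<dots> = (\<Sum>j\<in>S. \<Sum>l<i. (if j div ?n = l then 1 else 0) * (?x l p * ?x l q))"
      proof (rule sum.cong[OF refl])
        fix j assume "j \<in> S"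
        with S have "j div ?n < i" using div by auto
        have "(\<Sum>l<i. (if j div ?n = l then 1 else 0) * (?x l p * ?x l q)) =
            (\<Sum>l<i. if j div ?n = l then ?x l p * ?x l q else 0)"
          by (intro sum.cong) auto
        also have "\<dots> = ?x (j div ?n) p * ?x (j div ?n) q"
          using \<open>j div ?n < i\<close> by (subst sum.delta') simp_all
        finally show "?x (j div ?n) p * ?x (j div ?n) q =
            (\<Sum>l<i. (if j div ?n = l then 1 else 0) * (?x l p * ?x l q))" by simp
      qed
      also have "\<dots> = (\<Sum>l<i. ?s l * (?x l p * ?x l q))"
        by (subst sum.swap) (simp only: sum_distrib_right)
      finally show ?thesis .
    qed
    have "mat i i (\<Sum>j\<in>S. ?Bs ! j) = mat i i (\<lambda>(p, q). \<Sum>l<i. ?s l * (?x l p * ?x l q))"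
      by (rule eq_matI) (simp_all only: dim_row_mat dim_col_mat index_mat entry prod.case)
    then have "det (mat i i (\<Sum>j\<in>S. ?Bs ! j)) ^ ?n = ((\<Prod>l<i. ?s l) * ?D ^ 2) ^ ?n"
      by (simp only: det_gram)
    also have "\<dots> = (\<Prod>l<i. ?s l ^ ?n) * ?D ^ m"
      by (simp only: power_mult_distrib prod_power_distrib power_mult[symmetric] m2)
    \<comment> \<open>Each block contains exactly \<open>?n\<close> positions, so the powers become
      one product over all positions, as on the left of \<open>ryser\<close>.\<close>
    also have "(\<Prod>l<i. ?s l ^ ?n) = (\<Prod>l<i. \<Prod>p = l * ?n..<l * ?n + ?n. ?s (p div ?n))"
    proof (rule prod.cong[OF refl])
      fix l
      have "(\<Prod>p = l * ?n..<l * ?n + ?n. ?s (p div ?n)) = (\<Prod>p = l * ?n..<l * ?n + ?n. ?s l)"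
      proof (rule prod.cong[OF refl])
        fix p assume "p \<in> {l * ?n..<l * ?n + ?n}"
        then have "p div ?n = l"
          by (intro div_nat_eqI) (auto simp: mult.commute)
        then show "?s (p div ?n) = ?s l" by simp
      qed
      then show "?s l ^ ?n = (\<Prod>p = l * ?n..<l * ?n + ?n. ?s (p div ?n))" by simp
    qed
    also have "\<dots> = (\<Prod>p<?N. ?s (p div ?n))" by (rule prod.nat_group)
    finally show ?thesis .
  qed
  have "gamma_functional m i E e (pure (map (veronese m E) \<xi>s)) =
      (\<Sum>S\<in>Pow {..<?N}. ((-1) ^ (?N - card S) / fact ?N) * det (mat i i (\<Sum>j\<in>S. ?Bs ! j)) ^ ?n)"
    unfolding gamma_functional_def flat by (rule det_functional_symmetrize_pure[OF Bs])
  also have "\<dots> = (\<Sum>S\<in>Pow {..<?N}. ((-1) ^ (?N - card S) *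
      (\<Prod>p<?N. \<Sum>j\<in>S. if j div ?n = p div ?n then 1 else 0)) * (?D ^ m / fact ?N))"
    by (rule sum.cong[OF refl]) (simp only: det, simp)
  also have "\<dots> = (\<Sum>S\<in>Pow {..<?N}. (-1) ^ (?N - card S) *
      (\<Prod>p<?N. \<Sum>j\<in>S. if j div ?n = p div ?n then 1 else 0)) * (?D ^ m / fact ?N)"
    by (rule sum_distrib_right[symmetric])
  also have "\<dots> = block_permanent ?n i * (?D ^ m / fact ?N)"
    unfolding block_permanent_def
    using ryser[of ?N "\<lambda>p j. if j div ?n = p div ?n then 1 else 0"] by simp
  finally show ?thesis by simp
qed


section \<open>Polynomial dependence on parameters\<close>

definition polyfun :: "(complex \<Rightarrow> complex) \<Rightarrow> bool" where
  "polyfun h \<longleftrightarrow> (\<exists>p. \<forall>s. h s = poly p s)"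

lemma polyfun_const: "polyfun (\<lambda>s. c)"
  unfolding polyfun_def by (rule exI[of _ "[:c:]"]) simp

lemma polyfun_add: "polyfun f \<Longrightarrow> polyfun g \<Longrightarrow> polyfun (\<lambda>s. f s + g s)"
  unfolding polyfun_def by (metis poly_add)

lemma polyfun_mult: "polyfun f \<Longrightarrow> polyfun g \<Longrightarrow> polyfun (\<lambda>s. f s * g s)"
  unfolding polyfun_def by (metis poly_mult)

lemma polyfun_affine: "polyfun (\<lambda>s. a + s * b)"
  unfolding polyfun_def by (rule exI[of _ "[:a, b:]"]) simp

lemma polyfun_prod: "(\<And>j. j \<in> A \<Longrightarrow> polyfun (f j)) \<Longrightarrow> polyfun (\<lambda>s. \<Prod>j\<in>A. f j s)"
  by (induction A rule: infinite_finite_induct) (auto intro: polyfun_const polyfun_mult)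

lemma polyfun_power: "polyfun f \<Longrightarrow> polyfun (\<lambda>s. f s ^ n)"
  by (induction n) (auto intro: polyfun_const polyfun_mult)

text \<open>Tensors whose pairing is polynomial in \<open>s\<close> form a subspace, and pure
  tensors belong to it by assumption.\<close>

lemma polyfun_pairing:
  assumes U: "fin_dim U" and F: "\<And>s. F s \<in> tensor_power k (dual U)"
    and pol: "\<And>us. length us = k \<Longrightarrow> set us \<subseteq> U \<Longrightarrow> polyfun (\<lambda>s. F s us)"
    and t: "t \<in> tensor_power k U"
  shows "polyfun (\<lambda>s. pairing k U (F s) t)"
proof -
  let ?T = "tensor_power k U"
  let ?Q = "{t \<in> ?T. polyfun (\<lambda>s. pairing k U (F s) t)}"
  note lin = pairing_linear_right[OF U F]
  have zero: "pairing k U (F s) 0 = 0" for s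
    by (rule linear_on_0[OF vector_space_mult lin subspace_tensor_power])
  have "fn.subspace ?Q"
    unfolding fn.subspace_def
  proof (intro conjI ballI allI)
    show "0 \<in> ?Q"
      using fn.subspace_0[OF subspace_tensor_power[of k U]] by (simp add: zero polyfun_const)
    fix x assume x: "x \<in> ?Q"
    show "x + y \<in> ?Q" if "y \<in> ?Q" for y
      using x that fn.subspace_add[OF subspace_tensor_power[of k U], of x y]
      by (simp add: linear_on_add[OF lin] polyfun_add)
    show "fscale c x \<in> ?Q" for c
      using x fn.subspace_scale[OF subspace_tensor_power[of k U], of x c]
      by (simp add: linear_on_scale[OF lin] polyfun_mult polyfun_const)
  qed
  moreover have "pure ` words U k \<subseteq> ?Q"
  proof
    fix t' assume "t' \<in> pure ` words U k"
    then obtain us where "t' = pure us" "length us = k" "set us \<subseteq> U" by blast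
    then show "t' \<in> ?Q" using pol by (simp add: pure_in_tensor_power pairing_pure[OF U F])
  qed
  ultimately have "?T \<subseteq> ?Q"
    unfolding tensor_power_def[of k U] by (rule fn.span_minimal[rotated])
  with t show ?thesis by blast
qed

text \<open>The difference times \<open>p\<close> is a polynomial vanishing everywhere, hence zero,
  and there are no zero divisors. The roots of \<open>p\<close> are thereby included.\<close>

lemma polyfun_eqI:
  assumes f: "polyfun f" and g: "polyfun g" and p: "p \<noteq> 0"
    and eq: "\<And>s. poly p s \<noteq> 0 \<Longrightarrow> f s = g s"
  shows "f s = g s"
proof -
  obtain p1 p2 where 1: "\<And>s. f s = poly p1 s" and 2: "\<And>s. g s = poly p2 s"
    using f g unfolding polyfun_def by blast
  have "poly ((p1 - p2) * p) s = 0" for s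
    using eq[of s] by (cases "poly p s = 0") (simp_all add: 1 2)
  then have "(p1 - p2) * p = 0" using poly_all_0_iff_0 by blast
  with p show ?thesis by (simp add: 1 2)
qed


section \<open>Functoriality\<close>

lemma tensor_map_in_tensor_power:
  assumes U: "fin_dim U" and L: "linear_on fscale U L" and V: "L ` U \<subseteq> V"
    and t: "t \<in> tensor_power k U"
  shows "tensor_map k U L t \<in> tensor_power k V"
proof (rule linear_on_tensor_power_image[OF tensor_map_linear[OF U L] _ subspace_tensor_power t])
  fix us :: "('a \<Rightarrow> complex) list" assume us: "length us = k" "set us \<subseteq> U"
  then show "tensor_map k U L (pure us) \<in> tensor_power k V"
    unfolding tensor_map_pure[OF U L us] using V by (intro pure_in_tensor_power) auto
qed

lemma tensor_map_permute:
  assumes U: "fin_dim U" and L: "linear_on fscale U L" and t: "t \<in> tensor_power k U"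
    and \<sigma>: "\<sigma> permutes {..<k}"
  shows "tensor_map k U L (\<lambda>xs. t (permute_list \<sigma> xs)) = (\<lambda>xs. tensor_map k U L t (permute_list \<sigma> xs))"
proof (rule linear_on_tensor_power_eqI[OF vector_space_fscale _ _ _ t,
      where f = "\<lambda>t. tensor_map k U L (\<lambda>xs. t (permute_list \<sigma> xs))"
        and g = "\<lambda>t xs. tensor_map k U L t (permute_list \<sigma> xs)"])
  note lin = tensor_map_linear[OF U L, of k]
  have perm: "linear_on fscale V (\<lambda>t xs. t (permute_list \<sigma> xs))" for V :: "('z list \<Rightarrow> complex) set"
    by (intro linear_onI ext) (simp_all add: pointwise)
  show "linear_on fscale (tensor_power k U) (\<lambda>t. tensor_map k U L (\<lambda>xs. t (permute_list \<sigma> xs)))"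
    using tensor_power_permute[OF _ \<sigma>] by (intro linear_on_compose[OF perm lin]) auto
  show "linear_on fscale (tensor_power k U) (\<lambda>t xs. tensor_map k U L t (permute_list \<sigma> xs))"
    by (rule linear_on_compose[OF lin perm[of UNIV]]) simp
  fix us :: "('a \<Rightarrow> complex) list" assume us: "length us = k" "set us \<subseteq> U"
  have us': "length (permute_list (inv_into UNIV \<sigma>) us) = k" "set (permute_list (inv_into UNIV \<sigma>) us) \<subseteq> U"
    using us permutes_inv[OF \<sigma>] by auto
  show "tensor_map k U L (\<lambda>xs. pure us (permute_list \<sigma> xs)) = (\<lambda>xs. tensor_map k U L (pure us) (permute_list \<sigma> xs))"
    unfolding pure_permute[OF us(1) \<sigma>] tensor_map_pure[OF U L us] tensor_map_pure[OF U L us']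
    using us permutes_inv[OF \<sigma>] by (simp add: pure_permute[OF _ \<sigma>] permute_list_map)
qed

lemma tensor_map_in_sym_power:
  assumes U: "fin_dim U" and L: "linear_on fscale U L" and V: "L ` U \<subseteq> V"
    and t: "t \<in> sym_power k U"
  shows "tensor_map k U L t \<in> sym_power k V"
proof -
  have t': "t \<in> tensor_power k U" using t sym_power_subset by blast
  show ?thesis
    unfolding sym_power_def
  proof (intro CollectI conjI allI impI tensor_map_in_tensor_power[OF U L V t'])
    fix \<sigma> assume \<sigma>: "\<sigma> permutes {..<k}"
    with t have "(\<lambda>xs. t (permute_list \<sigma> xs)) = t" by (simp add: sym_power_def)
    then show "(\<lambda>xs. tensor_map k U L t (permute_list \<sigma> xs)) = tensor_map k U L t"
      using tensor_map_permute[OF U L t' \<sigma>] by simp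
  qed
qed

text \<open>On pure tensors both sides are the same product. Used at two levels: with
  \<open>m\<close> factors of \<open>E\<close> and with \<open>i\<close> factors of
  \<open>S^m(E)\<close>.\<close>

lemma pairing_tensor_map:
  assumes U: "fin_dim U" and V: "fin_dim V" and L: "linear_on fscale U L" "L ` U \<subseteq> V"
    and fs: "length fs = k" "set fs \<subseteq> dual V" and gs: "length gs = k" "set gs \<subseteq> dual U"
    and eq: "\<And>j u. j < k \<Longrightarrow> u \<in> U \<Longrightarrow> (gs ! j) u = (fs ! j) (L u)"
    and t: "t \<in> tensor_power k U"
  shows "pairing k V (pure fs) (tensor_map k U L t) = pairing k U (pure gs) t"
proof (rule linear_on_tensor_power_eqI[OF vector_space_mult _ pairing_linear_right[OF U] _ t,
      where f = "\<lambda>t. pairing k V (pure fs) (tensor_map k U L t)"])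
  have F: "pure fs \<in> tensor_power k (dual V)" and G: "pure gs \<in> tensor_power k (dual U)"
    using fs gs by (auto intro: pure_in_tensor_power)
  show "pure gs \<in> tensor_power k (dual U)" by fact
  show "linear_on (*) (tensor_power k U) (\<lambda>t. pairing k V (pure fs) (tensor_map k U L t))"
    using tensor_map_in_tensor_power[OF U L]
    by (intro linear_on_compose[OF tensor_map_linear[OF U L(1)] pairing_linear_right[OF V F]]) auto
  fix us :: "('a \<Rightarrow> complex) list" assume us: "length us = k" "set us \<subseteq> U"
  have Lus: "length (map L us) = k" "set (map L us) \<subseteq> V" using us L(2) by auto
  have "us ! j \<in> U" if "j < k" for j using us that by (meson nth_mem subsetD)
  then show "pairing k V (pure fs) (tensor_map k U L (pure us)) = pairing k U (pure gs) (pure us)"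
    unfolding tensor_map_pure[OF U L(1) us] pairing_pure[OF V F Lus] pairing_pure[OF U G us]
    using us fs(1) gs(1) eq by (simp add: pure_def)
qed


section \<open>Tensors as functions of matrices\<close>

locale basis =
  fixes i :: nat and E :: "('x \<Rightarrow> complex) set" and e :: "nat \<Rightarrow> 'x \<Rightarrow> complex"
  assumes inj: "inj_on e {..<i}"
    and independent: "fn.independent (e ` {..<i})"
    and span: "fn.span (e ` {..<i}) = E"
begin

lemma fin_dim: "fin_dim E"
  unfolding span[symmetric] by (rule fin_dim_span) simp

lemma subspace: "fn.subspace E"
  by (rule fin_dim_subspace[OF fin_dim])

lemma e_in: "j < i \<Longrightarrow> e j \<in> E"
  unfolding span[symmetric] by (rule fn.span_base) simp

text \<open>The functional with coordinates \<open>x\<close> in the basis dual to \<open>e\<close>;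
  for the \<open>l\<close>-th row of a matrix it is the \<open>\<xi>\<^sub>l\<close> of the
  introduction.\<close>

definition functional :: "(nat \<Rightarrow> complex) \<Rightarrow> ('x \<Rightarrow> complex) \<Rightarrow> complex" where
  "functional x = (\<lambda>u. if u \<in> E then \<Sum>j<i. x j * fn.representation (e ` {..<i}) u (e j) else 0)"

lemma functional_in_dual: "functional x \<in> dual E"
  unfolding functional_def
proof (rule restrict_in_dual[OF subspace], rule linear_onI)
  fix u v c assume u: "u \<in> E"
  show "(\<Sum>j<i. x j * fn.representation (e ` {..<i}) (fscale c u) (e j)) =
      c * (\<Sum>j<i. x j * fn.representation (e ` {..<i}) u (e j))"
    using u by (simp add: fn.representation_scale[OF independent] span sum_distrib_left algebra_simps)
  assume v: "v \<in> E"
  show "(\<Sum>j<i. x j * fn.representation (e ` {..<i}) (u + v) (e j)) =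
      (\<Sum>j<i. x j * fn.representation (e ` {..<i}) u (e j)) +
      (\<Sum>j<i. x j * fn.representation (e ` {..<i}) v (e j))"
    using u v by (simp add: fn.representation_add[OF independent] span sum.distrib algebra_simps)
qed

lemma functional_basis:
  assumes j: "j < i"
  shows "functional x (e j) = x j"
proof -
  have "functional x (e j) = (\<Sum>k<i. x k * fn.representation (e ` {..<i}) (e j) (e k))"
    by (simp add: functional_def e_in[OF j])
  also have "\<dots> = (\<Sum>k<i. if k = j then x k else 0)"
  proof (rule sum.cong[OF refl])
    fix k assume "k \<in> {..<i}"
    then show "x k * fn.representation (e ` {..<i}) (e j) (e k) = (if k = j then x k else 0)"
      using j inj by (auto simp: fn.representation_basis[OF independent] inj_on_def)
  qed
  also have "\<dots> = x j" using j by (simp add: sum.delta)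
  finally show ?thesis .
qed

lemma dual_eqI:
  assumes "\<xi> \<in> dual E" "\<eta> \<in> dual E" "\<And>j. j < i \<Longrightarrow> \<xi> (e j) = \<eta> (e j)"
  shows "\<xi> = \<eta>"
proof
  fix u
  show "\<xi> u = \<eta> u"
  proof (cases "u \<in> E")
    case True
    show ?thesis
      by (rule linear_on_span_eqI[OF vector_space_mult, of "e ` {..<i}"])
        (use assms True in \<open>auto simp: span dual_linear\<close>)
  qed (simp add: dual_outside[OF assms(1)] dual_outside[OF assms(2)])
qed

lemma functional_cong: "(\<And>j. j < i \<Longrightarrow> x j = y j) \<Longrightarrow> functional x = functional y"
  by (rule dual_eqI[OF functional_in_dual functional_in_dual]) (simp add: functional_basis)

abbreviation veroneses :: "nat \<Rightarrow> (nat \<Rightarrow> nat \<Rightarrow> complex) \<Rightarrow> (('x list \<Rightarrow> complex) \<Rightarrow> complex) list" where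
  "veroneses m X \<equiv> map (\<lambda>l. veronese m E (functional (X l))) [0..<i]"

text \<open>This is the function \<open>P\<^sub>t(X)\<close> of the introduction.\<close>

definition val :: "nat \<Rightarrow> ('x list list \<Rightarrow> complex) \<Rightarrow> (nat \<Rightarrow> nat \<Rightarrow> complex) \<Rightarrow> complex" where
  "val m t X = pairing i (sym_power m E) (pure (veroneses m X)) t"

lemma fin_dim_W: "fin_dim (sym_power m E)"
  by (rule fin_dim_sym_power[OF fin_dim])

lemma veroneses_in_dual: "length (veroneses m X) = i" "set (veroneses m X) \<subseteq> dual (sym_power m E)"
  using veronese_in_dual[OF fin_dim functional_in_dual] by auto

lemma pure_veroneses: "pure (veroneses m X) \<in> tensor_power i (dual (sym_power m E))"
  by (rule pure_in_tensor_power[OF veroneses_in_dual])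

lemma pure_veroneses_apply:
  "length ws = i \<Longrightarrow> pure (veroneses m X) ws = (\<Prod>l<i. veronese m E (functional (X l)) (ws ! l))"
  by (simp add: pure_def)

lemma val_linear: "linear_on (*) (tensor_power i (sym_power m E)) (\<lambda>t. val m t X)"
  unfolding val_def by (rule pairing_linear_right[OF fin_dim_W pure_veroneses])

lemma val_cong:
  assumes "\<And>l j. l < i \<Longrightarrow> j < i \<Longrightarrow> X l j = Y l j"
  shows "val m t X = val m t Y"
proof -
  have "functional (X l) = functional (Y l)" if "l < i" for l
    using assms that by (intro functional_cong) auto
  then have *: "veroneses m X = veroneses m Y" by (intro map_cong) auto
  show ?thesis unfolding val_def * ..
qed

text \<open>A functional on \<open>E\<close> is determined by its values on the basis, so the rows
  of matrices reach all products of \<open>m\<close>-th powers; these suffice by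
  \<open>dual_sym_power_eq_span\<close>.\<close>

lemma val_eqI:
  assumes t: "t \<in> tensor_power i (sym_power m E)" "t' \<in> tensor_power i (sym_power m E)"
    and eq: "\<And>X. val m t X = val m t' X"
  shows "t = t'"
proof (rule tensor_eqI[OF fin_dim_W t dual_sym_power_eq_span[OF fin_dim]])
  fix fs assume fs: "length fs = i" "set fs \<subseteq> veronese m E ` dual E"
  have "\<exists>\<xi>. \<xi> \<in> dual E \<and> fs ! l = veronese m E \<xi>" if "l < i" for l
  proof -
    have "fs ! l \<in> set fs" using that fs(1) by simp
    with fs(2) show ?thesis by blast
  qed
  then obtain \<xi> where \<xi>: "\<And>l. l < i \<Longrightarrow> \<xi> l \<in> dual E \<and> fs ! l = veronese m E (\<xi> l)"
    by metis
  have "fs = veroneses m (\<lambda>l j. \<xi> l (e j))"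
  proof (rule nth_equalityI)
    fix l assume "l < length fs"
    then have l: "l < i" using fs(1) by simp
    have "functional (\<lambda>j. \<xi> l (e j)) = \<xi> l"
      using \<xi>[OF l] by (intro dual_eqI functional_in_dual) (auto simp: functional_basis)
    then show "fs ! l = veroneses m (\<lambda>l j. \<xi> l (e j)) ! l" using \<xi>[OF l] l by simp
  qed (simp add: fs)
  then show "pairing i (sym_power m E) (pure fs) t = pairing i (sym_power m E) (pure fs) t'"
    using eq[of "\<lambda>l j. \<xi> l (e j)"] by (simp add: val_def)
qed

section \<open>The matrix function belonging to \<open>gamma\<close>\<close>

lemma gamma_functional_veroneses:
  assumes m: "even m"
  shows "gamma_functional m i E e (pure (veroneses m X)) =
    block_permanent (m div 2) i / fact (i * (m div 2)) * det (mat i i (\<lambda>(l, q). X l q)) ^ m"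
proof -
  let ?\<xi>s = "map (\<lambda>l. functional (X l)) [0..<i]"
  have *: "mat i i (\<lambda>(l, q). (?\<xi>s ! l) (e q)) = mat i i (\<lambda>(l, q). X l q)"
    by (rule eq_matI) (auto simp: functional_basis)
  have "set ?\<xi>s \<subseteq> dual E" using functional_in_dual by auto
  from gamma_functional_veronese[OF m fin_dim _ this, of i e]
  show ?thesis unfolding * by (simp add: e_in o_def)
qed

text \<open>It suffices to treat products of \<open>m\<close>-th powers. There, permuting the
  factors permutes the rows of the determinant, and the sign disappears in the even power
  \<open>m\<close>. The invariance is what makes the representing tensor symmetric.\<close>

lemma gamma_functional_permute:
  assumes m: "even m" and F: "F \<in> tensor_power i (dual (sym_power m E))"
    and \<sigma>: "\<sigma> permutes {..<i}"
  shows "gamma_functional m i E e (\<lambda>us. F (permute_list \<sigma> us)) = gamma_functional m i E e F"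
proof -
  let ?G = "gamma_functional m i E e" and ?V = "dual (sym_power m E)"
  note \<sigma>' = permutes_inv[OF \<sigma>]
  have T: "tensor_power i ?V = fn.span (pure ` words (veronese m E ` dual E) i)"
    unfolding dual_sym_power_eq_span[OF fin_dim] by (rule tensor_power_span)
  have lin: "linear_on (*) (tensor_power i ?V) ?G"
    by (rule gamma_functional_linear[OF fin_dim])
  have perm: "linear_on fscale (tensor_power i ?V) (\<lambda>F us. F (permute_list \<sigma> us))"
    by (intro linear_onI ext) (simp_all add: pointwise)
  have lin': "linear_on (*) (tensor_power i ?V) (\<lambda>F. ?G (\<lambda>us. F (permute_list \<sigma> us)))"
    using tensor_power_permute[OF _ \<sigma>] by (intro linear_on_compose[OF perm lin]) auto
  show ?thesis
  proof (rule linear_on_span_eqI[OF vector_space_mult lin'[unfolded T] lin[unfolded T] _ F[unfolded T]])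
    fix F assume "F \<in> pure ` words (veronese m E ` dual E) i"
    then obtain fs where fs: "F = pure fs" "length fs = i" "set fs \<subseteq> veronese m E ` dual E" by blast
    from fs(3) have "fs \<in> map (veronese m E) ` lists (dual E)"
      unfolding lists_image[symmetric] by (simp add: lists_eq_set)
    then obtain \<xi>s where \<xi>s: "fs = map (veronese m E) \<xi>s" "set \<xi>s \<subseteq> dual E"
      by (auto simp: lists_eq_set)
    have len: "length \<xi>s = i" using fs \<xi>s by simp
    let ?\<eta>s = "permute_list (inv_into UNIV \<sigma>) \<xi>s"
    let ?A = "mat i i (\<lambda>(l, q). (\<xi>s ! l) (e q))"
    have \<eta>s: "length ?\<eta>s = i" "set ?\<eta>s \<subseteq> dual E" using len \<xi>s(2) \<sigma>' by auto
    have "(\<lambda>us. F (permute_list \<sigma> us)) = pure (map (veronese m E) ?\<eta>s)"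
      unfolding fs(1) pure_permute[OF fs(2) \<sigma>] using \<xi>s(1) len \<sigma>' by (simp add: permute_list_map)
    then have "?G (\<lambda>us. F (permute_list \<sigma> us)) = block_permanent (m div 2) i / fact (i * (m div 2)) *
        det (mat i i (\<lambda>(l, q). (?\<eta>s ! l) (e q))) ^ m"
      using gamma_functional_veronese[OF m fin_dim \<eta>s, of e] e_in by simp
    also have "mat i i (\<lambda>(l, q). (?\<eta>s ! l) (e q)) = mat i i (\<lambda>(l, q). ?A $$ (inv_into UNIV \<sigma> l, q))"
    proof (rule eq_matI)
      fix l q assume "l < dim_row (mat i i (\<lambda>(l, q). ?A $$ (inv_into UNIV \<sigma> l, q)))"
        "q < dim_col (mat i i (\<lambda>(l, q). ?A $$ (inv_into UNIV \<sigma> l, q)))"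
      then have "l < i" "q < i" by auto
      moreover have "inv_into UNIV \<sigma> l < i" using \<open>l < i\<close> permutes_in_image[OF \<sigma>', of l] by simp
      ultimately show "mat i i (\<lambda>(l, q). (?\<eta>s ! l) (e q)) $$ (l, q) =
          mat i i (\<lambda>(l, q). ?A $$ (inv_into UNIV \<sigma> l, q)) $$ (l, q)"
        using \<sigma>' len by (simp add: permute_list_nth)
    qed simp_all
    also have "det \<dots> = signof (inv_into UNIV \<sigma>) * det ?A"
      by (rule det_permute_rows) (use \<sigma>' in \<open>simp_all add: atLeast0LessThan\<close>)
    also have "(signof (inv_into UNIV \<sigma>) * det ?A) ^ m = det ?A ^ m"
      using m by (simp add: sign_def power_mult_distrib)
    finally show "?G (\<lambda>us. F (permute_list \<sigma> us)) = ?G F"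
      using gamma_functional_veronese[OF m fin_dim len \<xi>s(2), of e] e_in fs(1) \<xi>s(1) by simp
  qed
qed

definition gamma_const :: "nat \<Rightarrow> complex" where
  "gamma_const m = block_permanent (m div 2) i / fact (i * (m div 2))"

lemma gamma_const_nonzero: "gamma_const m \<noteq> 0"
  by (simp add: gamma_const_def block_permanent_nonzero)

lemma gamma_in_sym_power: "even m \<Longrightarrow> gamma m i E e \<in> sym_power i (sym_power m E)"
  unfolding gamma_def
  by (rule symmetric_functional_representation(1)[OF fin_dim_W gamma_functional_linear[OF fin_dim]])
    (rule gamma_functional_permute)

lemma val_gamma:
  assumes "even m"
  shows "val m (gamma m i E e) X = gamma_const m * det (mat i i (\<lambda>(l, q). X l q)) ^ m"
proof -
  have "val m (gamma m i E e) X = gamma_functional m i E e (pure (veroneses m X))"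
    unfolding gamma_def val_def
    by (rule symmetric_functional_representation(2)[OF fin_dim_W gamma_functional_linear[OF fin_dim]
          _ pure_veroneses])
      (rule gamma_functional_permute[OF assms])
  then show ?thesis using assms by (simp add: gamma_functional_veroneses gamma_const_def)
qed

section \<open>Polynomial dependence on the matrix and homogeneity in its first row\<close>

lemma val_polyfun:
  assumes t: "t \<in> tensor_power i (sym_power m E)"
  shows "polyfun (\<lambda>s. val m t (\<lambda>l j. X l j + s * Y l j))"
  unfolding val_def
proof (rule polyfun_pairing[OF fin_dim_W pure_veroneses _ t])
  fix ws :: "('x list \<Rightarrow> complex) list"
  assume ws: "length ws = i" "set ws \<subseteq> sym_power m E"
  let ?\<xi> = "\<lambda>l s. functional (\<lambda>j. X l j + s * Y l j)"
  \<comment> \<open>The functional is affine in \<open>s\<close>; its power and the product over the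
    rows then remain polynomial in \<open>s\<close>.\<close>
  have affine: "polyfun (\<lambda>s. ?\<xi> l s u)" for l u
  proof -
    have "?\<xi> l s u = functional (X l) u + s * functional (Y l) u" for s
      by (simp add: functional_def sum.distrib sum_distrib_left algebra_simps)
    then show ?thesis by (simp add: polyfun_affine)
  qed
  have "polyfun (\<lambda>s. veronese m E (?\<xi> l s) w)" if w: "w \<in> sym_power m E" for l w
    unfolding veronese_eq[OF w]
  proof (rule polyfun_pairing[OF fin_dim pure_replicate_dual[OF functional_in_dual]])
    show "w \<in> tensor_power m E" using w sym_power_subset by blast
    show "polyfun (\<lambda>s. pure (replicate m (?\<xi> l s)) us)" if "length us = m" for us
      using that by (simp add: pure_replicate polyfun_prod affine)
  qed
  moreover have "ws ! l \<in> sym_power m E" if "l < i" for l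
    using ws that by (meson nth_mem subsetD)
  ultimately show "polyfun (\<lambda>s. pure (veroneses m (\<lambda>l j. X l j + s * Y l j)) ws)"
    using ws(1) by (auto simp: pure_def intro!: polyfun_prod)
qed

lemma veronese_scale:
  "veronese m E (fscale c (functional x)) = fscale (c ^ m) (veronese m E (functional x))"
proof
  fix w
  have *: "pure (replicate m (fscale c (functional x))) = fscale (c ^ m) (pure (replicate m (functional x)))"
    by (rule ext) (simp add: pure_replicate pointwise prod.distrib)
  show "veronese m E (fscale c (functional x)) w = fscale (c ^ m) (veronese m E (functional x)) w"
  proof (cases "w \<in> sym_power m E")
    case True
    then have w: "w \<in> tensor_power m E" using sym_power_subset by blast
    have "veronese m E (fscale c (functional x)) w =
        pairing m E (fscale (c ^ m) (pure (replicate m (functional x)))) w"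
      by (simp only: veronese_eq[OF True] *)
    also have "\<dots> = c ^ m * pairing m E (pure (replicate m (functional x))) w"
      by (rule linear_on_scale[OF pairing_linear_left[OF fin_dim w] pure_replicate_dual[OF functional_in_dual]])
    also have "\<dots> = fscale (c ^ m) (veronese m E (functional x)) w"
      unfolding veronese_eq[OF True, symmetric] by (simp add: fscale_apply)
    finally show ?thesis .
  qed (simp add: veronese_def dual_ident_def fscale_apply)
qed

text \<open>Only the first factor changes, and its \<open>m\<close>-th power turns \<open>c\<close>
  into \<open>c ^ m\<close>. Row \<open>0\<close> exists because \<open>i > 0\<close>.\<close>

lemma val_scale_row:
  assumes t: "t \<in> tensor_power i (sym_power m E)" and i: "i > 0"
  shows "val m t (X(0 := \<lambda>j. c * X 0 j)) = c ^ m * val m t X"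
proof -
  have f: "functional (\<lambda>j. c * X 0 j) = fscale c (functional (X 0))"
    by (rule ext) (simp add: functional_def fscale_apply sum_distrib_left mult.assoc)
  have "pure (veroneses m (X(0 := \<lambda>j. c * X 0 j))) = fscale (c ^ m) (pure (veroneses m X))"
  proof
    fix ws
    show "pure (veroneses m (X(0 := \<lambda>j. c * X 0 j))) ws = fscale (c ^ m) (pure (veroneses m X)) ws"
    proof (cases "length ws = i")
      case True
      have 0: "{..<i} = insert 0 {1..<i}" using i by auto
      have "(\<Prod>l = 1..<i. veronese m E (functional ((X(0 := \<lambda>j. c * X 0 j)) l)) (ws ! l)) =
          (\<Prod>l = 1..<i. veronese m E (functional (X l)) (ws ! l))"
        by (intro prod.cong) auto
      then have "(\<Prod>l<i. veronese m E (functional ((X(0 := \<lambda>j. c * X 0 j)) l)) (ws ! l)) =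
          c ^ m * (\<Prod>l<i. veronese m E (functional (X l)) (ws ! l))"
        unfolding 0 by (simp add: f veronese_scale fscale_apply)
      then show ?thesis by (simp only: pure_veroneses_apply[OF True] fscale_apply)
    qed (simp add: pure_def fscale_apply)
  qed
  then show ?thesis
    unfolding val_def
    by (simp add: linear_on_scale[OF pairing_linear_left[OF fin_dim_W t] pure_veroneses])
qed

section \<open>The action of endomorphisms on the matrix argument\<close>

lemma SL_maps:
  assumes g: "linear_on fscale E g" and A: "\<And>k. k < i \<Longrightarrow> g (e k) = (\<Sum>j<i. fscale (A $$ (j, k)) (e j))"
  shows "g ` E \<subseteq> E"
proof -
  \<comment> \<open>Linearity on \<open>E\<close> does not by itself confine the values to
    \<open>E\<close>; the images of the basis vectors do.\<close>
  have "g u \<in> E" if u: "u \<in> E" for u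
  proof (rule linear_on_span_image[OF g[folded span] _ subspace u[folded span]])
    fix b assume "b \<in> e ` {..<i}"
    then show "g b \<in> E"
      using A e_in by (auto intro!: fn.subspace_sum[OF subspace] fn.subspace_scale[OF subspace])
  qed
  then show ?thesis by blast
qed

text \<open>Pulling a row functional back along \<open>g\<close> multiplies the row by
  \<open>A\<close> on the right. Applying \<open>pairing_tensor_map\<close> inside
  \<open>S^m(E)\<close> and again to the product of \<open>i\<close> factors transfers this to
  \<open>t\<close>.\<close>

lemma val_tensor_map:
  assumes g: "linear_on fscale E g" and A: "\<And>k. k < i \<Longrightarrow> g (e k) = (\<Sum>j<i. fscale (A $$ (j, k)) (e j))"
    and t: "t \<in> tensor_power i (sym_power m E)"
  shows "tensor_map i (sym_power m E) (tensor_map m E g) t \<in> tensor_power i (sym_power m E)"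
    and "val m (tensor_map i (sym_power m E) (tensor_map m E g) t) X =
      val m t (\<lambda>l k. \<Sum>j<i. X l j * A $$ (j, k))"
proof -
  let ?W = "sym_power m E" and ?L = "tensor_map m E g"
  let ?Y = "\<lambda>l k. \<Sum>j<i. X l j * A $$ (j, k)"
  note gE = SL_maps[OF g A]
  have L: "linear_on fscale ?W ?L"
    by (rule linear_on_mono[OF tensor_map_linear[OF fin_dim g] sym_power_subset])
  have LW: "?L ` ?W \<subseteq> ?W"
    using tensor_map_in_sym_power[OF fin_dim g gE] by blast
  show "tensor_map i ?W ?L t \<in> tensor_power i ?W"
    by (rule tensor_map_in_tensor_power[OF fin_dim_W L LW t])
  have comp: "functional (?Y l) u = functional (X l) (g u)" if u: "u \<in> E" for l u
  proof -
    have lin: "linear_on (*) E (functional x)" for x by (rule dual_linear[OF functional_in_dual])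
    have "linear_on (*) E (\<lambda>u. functional (X l) (g u))"
      by (rule linear_on_compose[OF g lin gE])
    note lin2 = this
    show ?thesis
    proof (rule linear_on_span_eqI[where B = "e ` {..<i}" and f = "functional (?Y l)"
          and g = "\<lambda>u. functional (X l) (g u)", unfolded span, OF vector_space_mult lin lin2 _ u])
      fix b assume "b \<in> e ` {..<i}"
      then obtain k where k: "k < i" "b = e k" by blast
      have "functional (X l) (g (e k)) = (\<Sum>j<i. A $$ (j, k) * functional (X l) (e j))"
        unfolding A[OF k(1)] by (rule linear_on_sum[OF vector_space_mult lin subspace]) (simp add: e_in)
      then show "functional (?Y l) b = functional (X l) (g b)"
        using k by (simp add: functional_basis mult.commute)
    qed
  qed
  have ver: "veronese m E (functional (?Y l)) w = veronese m E (functional (X l)) (?L w)"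
    if w: "w \<in> ?W" for l w
  proof -
    have w': "w \<in> tensor_power m E" using w sym_power_subset by blast
    have Lw: "?L w \<in> ?W" using LW w by blast
    show ?thesis
      unfolding veronese_eq[OF w] veronese_eq[OF Lw]
      by (rule pairing_tensor_map[OF fin_dim fin_dim g gE _ _ _ _ _ w', symmetric])
        (auto simp: functional_in_dual comp)
  qed
  show "val m (tensor_map i ?W ?L t) X = val m t ?Y"
    unfolding val_def
    by (rule pairing_tensor_map[OF fin_dim_W fin_dim_W L LW veroneses_in_dual veroneses_in_dual _ t])
      (simp add: ver)
qed

lemma endomorphism_exists:
  "\<exists>g. linear_on fscale E g \<and> (\<forall>k<i. g (e k) = (\<Sum>j<i. fscale (A $$ (j, k)) (e j)))"
proof -
  \<comment> \<open>The dual basis, which extracts the coordinates of a vector.\<close>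
  let ?c = "\<lambda>k. functional (\<lambda>j. if j = k then 1 else 0)"
  let ?v = "\<lambda>k. \<Sum>j<i. fscale (A $$ (j, k)) (e j)"
  let ?g = "\<lambda>u. \<Sum>k<i. fscale (?c k u) (?v k)"
  have lin: "linear_on (*) E (?c k)" for k by (rule dual_linear[OF functional_in_dual])
  have "linear_on fscale E ?g"
    by (intro linear_onI ext)
      (simp_all add: pointwise linear_on_add[OF lin] linear_on_scale[OF lin] algebra_simps
        sum.distrib sum_distrib_left)
  moreover have "?g (e k) = ?v k" if k: "k < i" for k
  proof -
    have "?g (e k) = (\<Sum>r<i. if k = r then ?v r else 0)"
      by (intro sum.cong) (use k in \<open>auto simp: functional_basis fun_eq_iff pointwise\<close>)
    also have "\<dots> = ?v k" using k by (subst sum.delta') auto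
    finally show ?thesis .
  qed
  ultimately show ?thesis by blast
qed

text \<open>By \<open>val_tensor_map\<close> the matrix argument \<open>X\<close> becomes
  \<open>X A\<close>, and \<open>det A = 1\<close> leaves the power of the determinant
  unchanged.\<close>

lemma gamma_invariant:
  assumes m: "even m"
  shows "gamma m i E e \<in> SL_invariants m i E e"
proof -
  have mem: "gamma m i E e \<in> sym_power i (sym_power m E)" by (rule gamma_in_sym_power[OF m])
  then have t: "gamma m i E e \<in> tensor_power i (sym_power m E)" using sym_power_subset by blast
  have "tensor_map i (sym_power m E) (tensor_map m E g) (gamma m i E e) = gamma m i E e"
    if "g \<in> SL i E e" for g
  proof -
    from that obtain A where g: "linear_on fscale E g" and A: "A \<in> carrier_mat i i" "det A = 1"
      and gA: "\<And>k. k < i \<Longrightarrow> g (e k) = (\<Sum>j<i. fscale (A $$ (j, k)) (e j))"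
      unfolding SL_def by blast
    show ?thesis
    proof (rule val_eqI[OF val_tensor_map(1)[OF g gA t] t])
      fix X :: "nat \<Rightarrow> nat \<Rightarrow> complex"
      let ?X = "mat i i (\<lambda>(l, q). X l q)"
      have "mat i i (\<lambda>(l, k). \<Sum>j<i. X l j * A $$ (j, k)) = ?X * A"
        using A(1) by (intro eq_matI) (auto simp: scalar_prod_def atLeast0LessThan)
      then have "det (mat i i (\<lambda>(l, k). \<Sum>j<i. X l j * A $$ (j, k))) = det ?X"
        using det_mult[of ?X i A] A by simp
      then have "val m (gamma m i E e) (\<lambda>l k. \<Sum>j<i. X l j * A $$ (j, k)) = val m (gamma m i E e) X"
        by (simp only: val_gamma[OF m])
      then show "val m (tensor_map i (sym_power m E) (tensor_map m E g) (gamma m i E e)) X =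
          val m (gamma m i E e) X"
        using val_tensor_map(2)[OF g _ t, of A X] gA by simp
    qed
  qed
  with mem show ?thesis by (simp add: SL_invariants_def)
qed

section \<open>Uniqueness of the invariant up to a scalar\<close>

lemma val_invariant_nonsingular:
  assumes t: "t \<in> SL_invariants m i E e" and i: "i > 0"
    and d: "det (mat i i (\<lambda>(l, q). X l q)) \<noteq> 0"
  shows "val m t X = val m t (\<lambda>l q. if l = q then 1 else 0) * det (mat i i (\<lambda>(l, q). X l q)) ^ m"
proof -
  let ?X = "mat i i (\<lambda>(l, q). X l q)"
  let ?d = "det ?X" and ?I = "\<lambda>l q. if l = q then 1 else 0 :: complex"
  let ?c = "\<lambda>l. if l = 0 then ?d else 1"
  let ?D = "mat i i (\<lambda>(l, q). ?c l * ?I l q)"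
  have X: "?X \<in> carrier_mat i i" and D: "?D \<in> carrier_mat i i" by auto
  \<comment> \<open>The inverse of \<open>?X\<close> times \<open>?D\<close>, with the inverse
    written through the adjugate. Since \<open>?D\<close> also has determinant \<open>?d\<close>,
    this forces \<open>det A = 1\<close>.\<close>
  define A where "A = (1 / ?d) \<cdot>\<^sub>m (adj_mat ?X * ?D)"
  have A: "A \<in> carrier_mat i i" using adj_mat(1)[OF X] unfolding A_def by auto
  have "?X * A = (1 / ?d) \<cdot>\<^sub>m (?X * adj_mat ?X * ?D)"
    unfolding A_def assoc_mult_mat[OF X adj_mat(1)[OF X] D]
    by (rule mult_smult_distrib[OF X mult_carrier_mat[OF adj_mat(1)[OF X] D]])
  also have "\<dots> = (1 / ?d) \<cdot>\<^sub>m (?d \<cdot>\<^sub>m ?D)"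
    unfolding adj_mat(2)[OF X] mult_smult_assoc_mat[OF one_carrier_mat D] left_mult_one_mat[OF D]
    by (rule refl)
  also have "\<dots> = ?D" using d by (intro eq_matI) auto
  finally have XA: "?X * A = ?D" .
  have "det ?D = (\<Prod>l<i. ?c l) * det (mat i i (\<lambda>(l, q). ?I l q))" by (rule det_scale_rows)
  also have "mat i i (\<lambda>(l, q). ?I l q) = 1\<^sub>m i" by (rule eq_matI) auto
  \<comment> \<open>Only row \<open>0\<close> carries the factor \<open>?d\<close>, and it is
    present because \<open>i > 0\<close>.\<close>
  also have "(\<Prod>l<i. ?c l) = ?d" using i by (subst prod.delta) auto
  finally have "det ?X * det A = ?d" using det_mult[OF X A] XA by simp
  then have detA: "det A = 1" using d by simp
  obtain g where g: "linear_on fscale E g"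
    and gA: "\<And>k. k < i \<Longrightarrow> g (e k) = (\<Sum>j<i. fscale (A $$ (j, k)) (e j))"
    using endomorphism_exists[of A] by blast
  then have "g \<in> SL i E e" unfolding SL_def using A detA by blast
  with t have inv: "tensor_map i (sym_power m E) (tensor_map m E g) t = t"
    and "t \<in> sym_power i (sym_power m E)"
    by (auto simp: SL_invariants_def)
  then have t': "t \<in> tensor_power i (sym_power m E)" using sym_power_subset by blast
  have "val m t X = val m t (\<lambda>l k. \<Sum>j<i. X l j * A $$ (j, k))"
    using val_tensor_map(2)[OF g gA t', of X] inv by simp
  \<comment> \<open>\<open>?D\<close> is the identity matrix with its first row scaled by
    \<open>?d\<close>, the form required by \<open>val_scale_row\<close>.\<close>
  also have "\<dots> = val m t (?I(0 := \<lambda>j. ?d * ?I 0 j))"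
  proof (rule val_cong)
    fix l k assume lk: "l < i" "k < i"
    have "(\<Sum>j<i. X l j * A $$ (j, k)) = (?X * A) $$ (l, k)"
      using lk A by (simp add: scalar_prod_def atLeast0LessThan)
    then show "(\<Sum>j<i. X l j * A $$ (j, k)) = (?I(0 := \<lambda>j. ?d * ?I 0 j)) l k"
      unfolding XA using lk by simp
  qed
  also have "\<dots> = ?d ^ m * val m t ?I" by (rule val_scale_row[OF t' i])
  finally show ?thesis by (simp add: mult.commute)
qed

text \<open>Along the line \<open>X + s I\<close> the determinant is the characteristic polynomial
  of \<open>- ?X\<close> at \<open>s\<close>, which is monic and hence nonzero. The identity holds
  wherever it does not vanish, and since both sides are polynomial in \<open>s\<close> it persists
  at \<open>s = 0\<close>.\<close>

lemma val_invariant: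
  assumes t: "t \<in> SL_invariants m i E e" and i: "i > 0"
  shows "val m t X = val m t (\<lambda>l q. if l = q then 1 else 0) * det (mat i i (\<lambda>(l, q). X l q)) ^ m"
proof -
  let ?I = "\<lambda>l q. if l = q then 1 else 0 :: complex"
  let ?Y = "\<lambda>s l q. X l q + s * ?I l q"
  let ?M = "\<lambda>s. mat i i (\<lambda>(l, q). ?Y s l q)"
  let ?X = "mat i i (\<lambda>(l, q). X l q)"
  let ?p = "char_poly (- ?X)"
  have t': "t \<in> tensor_power i (sym_power m E)"
    using t sym_power_subset by (auto simp: SL_invariants_def)
  have X: "- ?X \<in> carrier_mat i i" by simp
  have det: "det (?M s) = poly ?p s" for s
  proof -
    have "- char_matrix (- ?X) s = ?M s"
      by (rule eq_matI) (auto simp: char_matrix_def)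
    then show ?thesis using char_poly_matrix[OF X, of s] by simp
  qed
  have p: "?p \<noteq> 0" using degree_monic_char_poly[OF X] by auto
  have "val m t (?Y 0) = val m t ?I * det (?M 0) ^ m"
  proof (rule polyfun_eqI[where f = "\<lambda>s. val m t (?Y s)" and g = "\<lambda>s. val m t ?I * det (?M s) ^ m",
        OF val_polyfun[OF t'] _ p])
    show "polyfun (\<lambda>s. val m t ?I * det (?M s) ^ m)"
      unfolding det by (intro polyfun_mult polyfun_power polyfun_const) (auto simp: polyfun_def)
    show "val m t (?Y s) = val m t ?I * det (?M s) ^ m" if "poly ?p s \<noteq> 0" for s
      using that by (intro val_invariant_nonsingular[OF t i]) (simp add: det)
  qed
  then show ?thesis by simp
qed

text \<open>Both tensors have values proportional to the same power of the determinant. The ratio of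
  the constants is read off at the identity matrix, and \<open>val_eqI\<close> lifts the
  proportionality to the tensors.\<close>

lemma invariant_multiple_of_gamma:
  assumes m: "even m" and i: "i > 0" and t: "t \<in> SL_invariants m i E e"
  shows "\<exists>c. t = fscale c (gamma m i E e)"
proof -
  let ?I = "\<lambda>l q. if l = q then 1 else 0 :: complex"
  let ?c = "val m t ?I / gamma_const m"
  have t': "t \<in> tensor_power i (sym_power m E)"
    using t sym_power_subset by (auto simp: SL_invariants_def)
  have g: "gamma m i E e \<in> tensor_power i (sym_power m E)"
    using gamma_in_sym_power[OF m] sym_power_subset by blast
  have "t = fscale ?c (gamma m i E e)"
  proof (rule val_eqI[OF t' fn.subspace_scale[OF subspace_tensor_power g]])
    fix X
    show "val m t X = val m (fscale ?c (gamma m i E e)) X"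
      unfolding linear_on_scale[OF val_linear g] val_gamma[OF m] val_invariant[OF t i, of X]
      using gamma_const_nonzero by simp
  qed
  then show ?thesis by blast
qed

text \<open>The value at the identity matrix is \<open>gamma_const m\<close>, whereas the zero
  tensor has value \<open>0\<close> there.\<close>

lemma gamma_nonzero:
  assumes m: "even m"
  shows "gamma m i E e \<noteq> 0"
proof
  let ?I = "\<lambda>l q. if l = q then 1 else 0 :: complex"
  assume 0: "gamma m i E e = 0"
  have "mat i i (\<lambda>(l, q). ?I l q) = 1\<^sub>m i" by (rule eq_matI) auto
  then have "val m (gamma m i E e) ?I = gamma_const m" by (simp add: val_gamma[OF m])
  moreover have "val m 0 ?I = 0"
    by (rule linear_on_0[OF vector_space_mult val_linear subspace_tensor_power])
  ultimately show False using 0 gamma_const_nonzero by simp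
qed

end

theorem lemma2p7:
  fixes m i :: nat
    and E :: "('x \<Rightarrow> complex) set"
    and e :: "nat \<Rightarrow> 'x \<Rightarrow> complex"
  assumes "even m" and "m > 0" and "i \<ge> 1"
    and "inj_on e {..<i}" and "fn.independent (e ` {..<i})" and "fn.span (e ` {..<i}) = E"
  shows "gamma m i E e \<in> SL_invariants m i E e \<and> gamma m i E e \<noteq> 0 \<and>
    (\<forall>t \<in> SL_invariants m i E e. \<exists>c. t = fscale c (gamma m i E e))"
proof -
  interpret basis i E e using assms(4-6) by unfold_locales
  show ?thesis
    using gamma_invariant gamma_nonzero invariant_multiple_of_gamma assms(1,3) by simp
qed

end
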